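(* Let $\Gamma$ be a graph, $r\geq 1$ and $n\geq 2$ integers. If $\mathrm{Hom}(C_{2r+1},\Gamma)$ is $(n-1)$-connected, then $\Gamma$ is not $(n+2)$-colorable.
   Context: Graphs are undirected. $C_{2r+1}$ is the circular graph (cycle) with $2r+1$ edges. A graph is $m$-colorable if there is a graph homomorphism from it to the complete graph $K_m$. For graphs $H$ ($H$ finite) and $\Gamma$, $\mathrm{Hom}(H,\Gamma)$ denotes the usual Hom complex: the polyhedral complex whose cells are the maps $\eta$ assigning to each vertex $v\in V(H)$ a nonempty finite subset $\eta(v)\subseteq V(\Gamma)$ such that whenever $\{v,w\}$ is an edge of $H$, every $x\in\eta(v)$ and $y\in\eta(w)$ are adjacent in $\Gamma$; the cell of $\eta$ is the product over $v\in V(H)$ of the simplices with vertex sets $\eta(v)$, and faces are given by componentwise inclusion. (Up to homeomorphism it is the geometric realization of the order complex of the poset of such $\eta$ ordered by componentwise inclusion.) A $k$-connected space ($k\ge 0$) is nonempty, and its homotopy groups $\pi_i$ vanish for $0\le i\le k$. *)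

theory Defs
  imports "HOL-Analysis.Analysis" "Graph_Theory.Pair_Digraph"
begin

section \<open>Graphs\<close>

text \<open>
  An undirected graph is a symmetric relation on a vertex set
  (\<^locale>\<open>pair_sym_digraph\<close>); an edge contributes both of its orientations. The vertex set
  may be infinite and loops are permitted.
\<close>

definition circular_graph :: "nat \<Rightarrow> nat pair_pre_digraph" where
  "circular_graph m =
     \<lparr> pverts = {..<m},
       parcs = {(i, j). i < m \<and> j < m \<and> (j = (i + 1) mod m \<or> i = (j + 1) mod m)} \<rparr>"

definition complete_graph :: "nat \<Rightarrow> nat pair_pre_digraph" where
  "complete_graph m = \<lparr> pverts = {..<m}, parcs = {(i, j). i < m \<and> j < m \<and> i \<noteq> j} \<rparr>"

definition graph_hom ::
    "('a \<Rightarrow> 'b) \<Rightarrow> 'a pair_pre_digraph \<Rightarrow> 'b pair_pre_digraph \<Rightarrow> bool" where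
  "graph_hom f G H \<longleftrightarrow>
     f \<in> pverts G \<rightarrow> pverts H \<and> (\<forall>(u, v) \<in> parcs G. (f u, f v) \<in> parcs H)"

definition colorable :: "nat \<Rightarrow> 'a pair_pre_digraph \<Rightarrow> bool" where
  "colorable m G \<longleftrightarrow> (\<exists>f. graph_hom f G (complete_graph m))"

lemma pair_sym_digraph_circular_graph: "pair_sym_digraph (circular_graph m)"
  by unfold_locales (auto simp: circular_graph_def symmetric_def sym_def)

lemma pair_sym_digraph_complete_graph: "pair_sym_digraph (complete_graph m)"
  by unfold_locales (auto simp: complete_graph_def symmetric_def sym_def)

section \<open>The Hom complex\<close>

definition hom_cells ::
    "'h pair_pre_digraph \<Rightarrow> 'a pair_pre_digraph \<Rightarrow> ('h \<Rightarrow> 'a set) set" where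
  "hom_cells H G =
     {\<eta> \<in> pverts H \<rightarrow>\<^sub>E {S. finite S \<and> S \<noteq> {} \<and> S \<subseteq> pverts G}.
        \<forall>(v, w) \<in> parcs H. \<forall>x \<in> \<eta> v. \<forall>y \<in> \<eta> w. (x, y) \<in> parcs G}"

text \<open>
  The simplex with finite vertex set \<open>S\<close>, in barycentric coordinates. Its topology is that of
  pointwise convergence, which is the Euclidean one because only the finitely many coordinates
  in \<open>S\<close> can be nonzero.
\<close>

definition vertex_simplex :: "'a set \<Rightarrow> ('a \<Rightarrow> real) set" where
  "vertex_simplex S = {p. (\<forall>x. 0 \<le> p x) \<and> (\<forall>x. x \<notin> S \<longrightarrow> p x = 0) \<and> sum p S = 1}"

definition cell_topology :: "'h set \<Rightarrow> ('h \<Rightarrow> 'a set) \<Rightarrow> ('h \<Rightarrow> 'a \<Rightarrow> real) topology" where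
  "cell_topology V \<eta> = product_topology (\<lambda>v. top_of_set (vertex_simplex (\<eta> v))) V"

text \<open>
  The cells are glued along their common faces simply by forming their union, since the
  face of \<open>\<eta>\<close> given by a componentwise smaller \<open>\<eta>'\<close> is literally a subset of the cell of \<open>\<eta>\<close>.
  The union carries the weak topology determined by the closed cells.
\<close>

definition hom_complex ::
    "'h pair_pre_digraph \<Rightarrow> 'a pair_pre_digraph \<Rightarrow> ('h \<Rightarrow> 'a \<Rightarrow> real) topology" where
  "hom_complex H G = topology (\<lambda>U.
     U \<subseteq> (\<Union>\<eta> \<in> hom_cells H G. topspace (cell_topology (pverts H) \<eta>)) \<and>
     (\<forall>\<eta> \<in> hom_cells H G. openin (cell_topology (pverts H) \<eta>)
        (U \<inter> topspace (cell_topology (pverts H) \<eta>))))"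

lemma istopology_weak:
  "istopology (\<lambda>U. U \<subseteq> (\<Union>i \<in> I. topspace (X i)) \<and>
     (\<forall>i \<in> I. openin (X i) (U \<inter> topspace (X i))))"
proof -
  have *: "openin (X i) (S \<inter> T \<inter> topspace (X i))"
    if "openin (X i) (S \<inter> topspace (X i))" "openin (X i) (T \<inter> topspace (X i))" for i S T
  proof -
    have "S \<inter> T \<inter> topspace (X i) = (S \<inter> topspace (X i)) \<inter> (T \<inter> topspace (X i))"
      by blast
    then show ?thesis
      using openin_Int[OF that] by simp
  qed
  have **: "openin (X i) (\<Union>\<K> \<inter> topspace (X i))"
    if "\<forall>K \<in> \<K>. openin (X i) (K \<inter> topspace (X i))" for i \<K>
  proof -
    have "\<Union>\<K> \<inter> topspace (X i) = (\<Union>K \<in> \<K>. K \<inter> topspace (X i))"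
      by blast
    then show ?thesis
      using that by (metis (mono_tags, lifting) imageE openin_Union)
  qed
  show ?thesis
    unfolding istopology_def by (intro conjI allI impI ballI * **; blast)
qed

lemma openin_hom_complex:
  "openin (hom_complex H G) U \<longleftrightarrow>
     U \<subseteq> (\<Union>\<eta> \<in> hom_cells H G. topspace (cell_topology (pverts H) \<eta>)) \<and>
     (\<forall>\<eta> \<in> hom_cells H G. openin (cell_topology (pverts H) \<eta>)
        (U \<inter> topspace (cell_topology (pverts H) \<eta>)))"
  unfolding hom_complex_def topology_inverse'[OF istopology_weak] ..

section \<open>Homotopy groups and connectivity\<close>

definition cube :: "nat \<Rightarrow> (nat \<Rightarrow> real) topology" where
  "cube i = product_topology (\<lambda>_. top_of_set {0..1}) {..<i}"

definition cube_boundary :: "nat \<Rightarrow> (nat \<Rightarrow> real) set" where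
  "cube_boundary i = {x \<in> topspace (cube i). \<exists>j<i. x j = 0 \<or> x j = 1}"

definition homotopic_rel_boundary ::
    "nat \<Rightarrow> 'a topology \<Rightarrow> 'a \<Rightarrow> ((nat \<Rightarrow> real) \<Rightarrow> 'a) \<Rightarrow> ((nat \<Rightarrow> real) \<Rightarrow> 'a) \<Rightarrow> bool" where
  "homotopic_rel_boundary i X x0 =
     homotopic_with (\<lambda>h. \<forall>x \<in> cube_boundary i. h x = x0) (cube i) X"

text \<open>
  The underlying set of the homotopy group: homotopy classes, relative to the boundary, of maps
  from the cube to \<open>X\<close> that send the boundary to the base point. For \<open>i = 0\<close> the cube is a point
  with empty boundary, so this is the set of path components. The group structure (for
  \<open>i \<ge> 1\<close>) plays no role for vanishing.
\<close>

definition homotopy_group_carrier ::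
    "nat \<Rightarrow> 'a topology \<Rightarrow> 'a \<Rightarrow> ((nat \<Rightarrow> real) \<Rightarrow> 'a) set set" where
  "homotopy_group_carrier i X x0 =
     {f. continuous_map (cube i) X f \<and> (\<forall>x \<in> cube_boundary i. f x = x0)} //
       {(f, g). homotopic_rel_boundary i X x0 f g}"

definition k_connected :: "nat \<Rightarrow> 'a topology \<Rightarrow> bool" where
  "k_connected k X \<longleftrightarrow>
     topspace X \<noteq> {} \<and>
     (\<forall>i \<le> k. \<forall>x0 \<in> topspace X. is_singleton (homotopy_group_carrier i X x0))"

end

theory Submission
  imports Defs "HOL-Homology.Homology"
begin

text \<open>
  Let \<open>m = 2 * r + 1\<close> and suppose that \<open>\<Gamma>\<close> is coloured with \<open>n + 2\<close> colours. A point of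
  \<open>Hom(C\<^sub>m, \<Gamma>)\<close> assigns to each vertex of the cycle a probability distribution on the vertices of
  \<open>\<Gamma>\<close>; pushing it forward along the colouring gives a distribution on the colours. Adjacent vertices of the
  cycle receive distributions with disjoint supports, so their difference is a nonzero vector in
  the hyperplane of vectors with coordinate sum 0, a space of dimension \<open>n + 1\<close>. Every edge of the
  cycle thus gives a map from the Hom complex to a sphere of dimension \<open>n\<close>.

  The cycle has a reflection, which fixes the vertex 0 and flips the opposite edge \<open>{r, r + 1}\<close>.
  The reflection acts on the Hom complex, and because the complex is \<open>(n - 1)\<close>-connected there is
  an equivariant map \<open>s\<close> from \<open>S\<^sup>n\<close> with the antipodal action: extend it from each sphere over the
  upper hemisphere of the next one, and by symmetry over the lower hemisphere
  (\<open>equivariant_map_from_sphere\<close>). Let \<open>a v\<close> be the distribution of colours at the vertex \<open>v\<close>,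
  composed with \<open>s\<close>. Once normalised, \<open>a r - a (r + 1)\<close> is an odd map from \<open>S\<^sup>n\<close> to itself, whereas
  \<open>a 0 - (a 1 + a (2 * r)) / 2\<close> is an even one. The two are homotopic up to sign:
  if two neighbours of a vertex are exchanged by moving linearly from one to the other, then the
  support stays disjoint from that of the vertex, so the difference never vanishes, and such moves
  walk from the vertex 0 to the opposite edge (\<open>no_antipodal_odd_cycle_of_distributions\<close>).

  This is impossible, since odd self-maps of a sphere have odd degree and even ones have even
  degree. Rather than computing degrees, \<open>odd_map_not_homotopic_to_even_map\<close> works with one cycle.
  Write \<open>T\<close> for the antipodal map and choose singular chains \<open>c\<^sub>k\<close> in the upper hemisphere of
  \<open>S\<^sup>k\<close>, starting with a point, such that \<open>c\<^sub>k\<^sub>+\<^sub>1\<close> has boundary \<open>T c\<^sub>k \<plusminus> c\<^sub>k\<close>. The cycle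
  \<open>z = T c\<^sub>n \<plusminus> c\<^sub>n\<close> is not twice a homology class, which the hemisphere isomorphisms reduce to
  dimension 0 (\<open>top_cycle_odd\<close>). An odd map preserves \<open>z\<close> up to twice a class, because its image
  comes from another sequence of chains of the same kind and the two sequences can be compared in
  degrees below \<open>n\<close>, where the reduced homology of the sphere vanishes (\<open>odd_map_fixes_top_cycle_mod_2\<close>). An even map
  \<open>g\<close> sends \<open>z\<close> to \<open>g c\<^sub>n \<plusminus> g c\<^sub>n\<close>, which is twice a cycle or 0
  (\<open>even_map_kills_top_cycle_mod_2\<close>).
\<close>

section \<open>The antipodal map\<close>

definition antipode :: "(nat \<Rightarrow> real) \<Rightarrow> nat \<Rightarrow> real" where
  "antipode x = (\<lambda>i. - x i)"

lemma antipode_antipode [simp]: "antipode (antipode x) = x"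
  by (simp add: antipode_def)

lemma antipode_comp_antipode [simp]: "antipode \<circ> antipode = id"
  by (simp add: fun_eq_iff)

lemma antipode_apply [simp]: "antipode x i = - x i"
  by (simp add: antipode_def)

lemma topspace_nsphere: "x \<in> topspace (nsphere n) \<longleftrightarrow> (\<Sum>i\<le>n. (x i)\<^sup>2) = 1 \<and> (\<forall>i>n. x i = 0)"
  by (simp add: nsphere)

lemma antipode_in_nsphere [simp]:
  "antipode x \<in> topspace (nsphere n) \<longleftrightarrow> x \<in> topspace (nsphere n)"
  by (simp add: topspace_nsphere)

lemma continuous_map_antipode: "continuous_map (nsphere n) (nsphere n) antipode"
proof -
  have "continuous_map (powertop_real UNIV) euclideanreal (\<lambda>x. - x k)" for k :: nat
    by (metis UNIV_I continuous_map_product_projection continuous_map_minus)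
  then show ?thesis
    by (force simp: nsphere continuous_map_in_subtopology continuous_map_componentwise_UNIV antipode_def
        intro: continuous_map_from_subtopology)
qed

lemma chain_map_antipode_antipode:
  assumes "singular_chain p X c"
  shows "chain_map p antipode (chain_map p antipode c) = c"
proof -
  have "chain_map p antipode (chain_map p antipode c) = chain_map p (antipode \<circ> antipode) c"
    using chain_map_compose[of p antipode antipode] by (metis comp_apply)
  then show ?thesis
    using assms by (simp add: chain_map_ident)
qed

lemma singular_chain_antipode:
  "singular_chain p (nsphere n) c \<Longrightarrow> singular_chain p (nsphere n) (chain_map p antipode c)"
  using continuous_map_antipode singular_chain_chain_map by blast

text \<open>
  All spheres consist of functions on the natural numbers, so that a sphere of lower dimension
  is literally an iterated equator.
\<close>

lemma singular_chain_nsphere_mono: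
  assumes "k \<le> n" "singular_chain p (nsphere k) c"
  shows "singular_chain p (nsphere n) c"
  using assms
proof (induction n rule: dec_induct)
  case (step m)
  then show ?case
    by (metis singular_chain_subtopology subtopology_nsphere_equator)
qed

section \<open>Chains resolving the antipodal action\<close>

text \<open>
  Writing \<open>T\<close> for the antipodal map, these are the operators \<open>T + 1\<close> and \<open>T - 1\<close> on chains,
  selected by the parity of \<open>s\<close>. Their product is \<open>T\<^sup>2 - 1 = 0\<close>, and alternating between them
  is the standard free resolution of the integers over the group of order 2.
\<close>

definition twist :: "nat \<Rightarrow> nat \<Rightarrow> (nat \<Rightarrow> real) chain \<Rightarrow> (nat \<Rightarrow> real) chain" where
  "twist s p c = chain_map p antipode c + frag_cmul ((-1) ^ s) c"

lemma twist_add: "twist s p (a + b) = twist s p a + twist s p b"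
  by (simp add: twist_def chain_map_add frag_cmul_distrib2)

lemma twist_diff: "twist s p (a - b) = twist s p a - twist s p b"
proof -
  have "twist s p (a - b + b) = twist s p (a - b) + twist s p b"
    by (rule twist_add)
  then show ?thesis
    by simp
qed

lemma twist_0 [simp]: "twist s p 0 = 0"
  by (simp add: twist_def)

lemma singular_chain_twist:
  "singular_chain p (nsphere n) c \<Longrightarrow> singular_chain p (nsphere n) (twist s p c)"
  by (simp add: twist_def singular_chain_add singular_chain_antipode singular_chain_cmul)

lemma chain_boundary_twist:
  assumes "singular_chain (Suc p) X c"
  shows "chain_boundary (Suc p) (twist s (Suc p) c) = twist s p (chain_boundary (Suc p) c)"
  using chain_boundary_chain_map[OF assms, of antipode]
  by (simp add: twist_def chain_boundary_add chain_boundary_cmul)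

lemma frag_cmul_neg1_power:
  "frag_cmul ((-1) ^ s) c = (if even s then c else - c)"
  by (auto simp: frag_cmul_minus_one)

lemma twist_twist:
  assumes "singular_chain p X c"
  shows "twist (Suc s) p (twist s p c) = 0" "twist s p (twist (Suc s) p c) = 0"
  using chain_map_antipode_antipode[OF assms]
  by (auto simp: twist_def frag_cmul_neg1_power chain_map_add chain_map_minus)

lemma chain_map_twist_odd:
  assumes "singular_chain p (nsphere m) c"
    and "\<And>x. x \<in> topspace (nsphere m) \<Longrightarrow> f (antipode x) = antipode (f x)"
  shows "chain_map p f (twist s p c) = twist s p (chain_map p f c)"
proof -
  have "chain_map p (f \<circ> antipode) c = chain_map p (antipode \<circ> f) c"
    using assms by (intro chain_map_eq) auto
  then show ?thesis
    by (simp add: twist_def chain_map_add chain_map_compose)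
qed

lemma cycle_bounds_if_trivial:
  assumes "trivial_group (homology_group (int p) X)" "singular_relcycle p X {} c"
  shows "\<exists>d. singular_chain (Suc p) X d \<and> chain_boundary (Suc p) d = c"
proof -
  have "homologous_rel_set p X {} c \<in> carrier (homology_group (int p) X)"
    using assms(2) by (auto simp: carrier_relative_homology_group)
  then have "homologous_rel_set p X {} c = singular_relboundary_set p X {}"
    using assms(1) by (simp add: trivial_group_def)
  then show ?thesis
    by (metis homologous_rel_set_eq_relboundary singular_boundary)
qed

lemma cycle_bounds_contractible:
  assumes "contractible_space X" "p \<ge> 1" "singular_relcycle p X {} c"
  shows "\<exists>d. singular_chain (Suc p) X d \<and> chain_boundary (Suc p) d = c"
proof (rule cycle_bounds_if_trivial[OF _ assms(3)])
  show "trivial_group (homology_group (int p) X)"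
    using trivial_reduced_homology_group_contractible_space[OF assms(1), of p] assms(2)
    by (simp add: un_reduced_homology_group)
qed

lemma cycle_bounds_nsphere:
  assumes "p \<noteq> n" "p \<ge> 1" "singular_relcycle p (nsphere n) {} c"
  shows "\<exists>d. singular_chain (Suc p) (nsphere n) d \<and> chain_boundary (Suc p) d = c"
proof (rule cycle_bounds_if_trivial[OF _ assms(3)])
  show "trivial_group (homology_group (int p) (nsphere n))"
    using trivial_reduced_homology_group_nsphere[of p n] assms(1,2)
    by (simp add: un_reduced_homology_group)
qed

lemma difference_of_points_bounds:
  assumes "path_connected_space X" "singular_simplex 0 X f" "singular_simplex 0 X g"
  shows "\<exists>d. singular_chain 1 X d \<and> chain_boundary 1 d = frag_of f - frag_of g"
  using iso_integer_zeroth_homology_group_aux[OF assms]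
  unfolding homologous_rel_def singular_boundary by simp

definition upper_hemisphere :: "nat \<Rightarrow> (nat \<Rightarrow> real) topology" where
  "upper_hemisphere n = subtopology (nsphere n) {x. x n \<ge> 0}"

lemma contractible_upper_hemisphere: "contractible_space (upper_hemisphere n)"
  unfolding upper_hemisphere_def by (intro contractible_space_upper_hemisphere) simp

lemma path_connected_space_nsphere:
  assumes "n \<ge> 1"
  shows "path_connected_space (nsphere n)"
proof -
  let ?U = "topspace (nsphere n) \<inter> {x. x n \<ge> 0}" and ?L = "topspace (nsphere n) \<inter> {x. x n \<le> 0}"
  have "path_connectedin (nsphere n) ?U" "path_connectedin (nsphere n) ?L"
    using contractible_space_upper_hemisphere[of n n] contractible_space_lower_hemisphere[of n n]
    by (auto simp: path_connectedin_def contractible_imp_path_connected_space subtopology_restrict)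
  moreover have "(\<lambda>i. if i = 0 then 1 else 0) \<in> ?U \<inter> ?L"
    using in_topspace_nsphere[of n] assms by simp
  ultimately have "path_connectedin (nsphere n) (?U \<union> ?L)"
    using path_connectedin_Un by blast
  moreover have "?U \<union> ?L = topspace (nsphere n)"
    by auto
  ultimately show ?thesis
    by (simp add: path_connectedin_topspace)
qed

definition base_point :: "(nat \<Rightarrow> real) \<Rightarrow> nat \<Rightarrow> real" where
  "base_point = restrict (\<lambda>_ i. if i = 0 then 1 else 0) (standard_simplex 0)"

lemma base_point: "singular_simplex 0 (upper_hemisphere 0) base_point"
  unfolding singular_simplex_def base_point_def upper_hemisphere_def
  by (auto simp: continuous_map_in_subtopology in_topspace_nsphere)

text \<open>
  The chain \<open>c k\<close> plays the role of the upper cell of the sphere of dimension \<open>k\<close>, decomposed into two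
  cells in each dimension: its boundary is the equatorial sphere, which in turn is made of
  \<open>c (k - 1)\<close> and its antipode.
\<close>

definition resolution :: "(nat \<Rightarrow> (nat \<Rightarrow> real) chain) \<Rightarrow> bool" where
  "resolution c \<longleftrightarrow> c 0 = frag_of base_point \<and>
     (\<forall>k. singular_chain k (upper_hemisphere k) (c k)) \<and>
     (\<forall>k. chain_boundary (Suc k) (c (Suc k)) = twist (Suc k) k (c k))"

lemma singular_chain_upper_hemisphere: "singular_chain p (upper_hemisphere n) c \<Longrightarrow> singular_chain p (nsphere n) c"
  by (simp add: upper_hemisphere_def singular_chain_subtopology)

lemma upper_hemisphere_equator: "subtopology (upper_hemisphere (Suc n)) {x. x (Suc n) = 0} = nsphere n"
proof -
  have "{x. 0 \<le> x (Suc n)} \<inter> {x. x (Suc n) = 0} = {x. x (Suc n) = (0::real)}"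
    by auto
  then show ?thesis
    by (simp add: upper_hemisphere_def subtopology_subtopology subtopology_nsphere_equator)
qed

lemma singular_chain_equator: "singular_chain p (nsphere n) c \<Longrightarrow> singular_chain p (upper_hemisphere (Suc n)) c"
  using upper_hemisphere_equator singular_chain_subtopology by metis

text \<open>
  The prescribed boundary \<open>twist (Suc k) k (c k)\<close> is a cycle on the equator of the contractible
  upper hemisphere of the next sphere, so it can be filled there.
\<close>

lemma resolution_exists: "\<exists>c. resolution c"
proof -
  define P where "P k c \<longleftrightarrow> singular_chain k (upper_hemisphere k) c \<and> (k = 0 \<longrightarrow> c = frag_of base_point) \<and>
     chain_boundary k (twist (Suc k) k c) = 0" for k c
  have "\<exists>c. \<forall>k. P k (c k) \<and> chain_boundary (Suc k) (c (Suc k)) = twist (Suc k) k (c k)"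
  proof (rule dependent_nat_choice)
    show "\<exists>c. P 0 c"
      by (auto simp: P_def singular_chain_of base_point chain_boundary_def)
  next
    fix c k
    assume P: "P k c"
    then have c: "singular_chain k (nsphere k) c"
      by (auto simp: P_def singular_chain_upper_hemisphere)
    have z: "singular_chain k (upper_hemisphere (Suc k)) (twist (Suc k) k c)"
      using c by (intro singular_chain_equator singular_chain_twist)
    have "\<exists>d. singular_chain (Suc k) (upper_hemisphere (Suc k)) d \<and> chain_boundary (Suc k) d = twist (Suc k) k c"
    proof (cases k)
      case 0
      have "singular_simplex 0 (upper_hemisphere 1) base_point"
        "singular_simplex 0 (upper_hemisphere 1) (simplex_map 0 antipode base_point)"
        using singular_chain_equator[of 0 0 "frag_of base_point"]
          singular_chain_equator[of 0 0 "chain_map 0 antipode (frag_of base_point)"] P 0 c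
          singular_chain_antipode[of 0 0 "frag_of base_point"]
        by (auto simp: P_def singular_chain_of)
      then show ?thesis
        using difference_of_points_bounds[of "upper_hemisphere 1" "simplex_map 0 antipode base_point" base_point]
          contractible_upper_hemisphere[of 1] P 0
        by (auto simp: contractible_imp_path_connected_space P_def twist_def)
    next
      case (Suc j)
      have "singular_relcycle k (upper_hemisphere (Suc k)) {} (twist (Suc k) k c)"
        using z P by (simp add: singular_cycle P_def)
      then show ?thesis
        using cycle_bounds_contractible[OF contractible_upper_hemisphere] Suc by simp
    qed
    then obtain d where d: "singular_chain (Suc k) (upper_hemisphere (Suc k)) d"
        "chain_boundary (Suc k) d = twist (Suc k) k c"
      by blast
    have "P (Suc k) d"
      using d twist_twist[OF c] by (simp add: P_def chain_boundary_twist)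
    then show "\<exists>d. P (Suc k) d \<and> chain_boundary (Suc k) d = twist (Suc k) k c"
      using d by blast
  qed
  then show ?thesis
    unfolding resolution_def P_def by metis
qed

lemma resolution_nsphere:
  assumes "resolution c" "k \<le> n"
  shows "singular_chain k (nsphere n) (c k)"
  using assms singular_chain_upper_hemisphere singular_chain_nsphere_mono unfolding resolution_def by blast

lemma resolution_cycle:
  assumes "resolution c"
  shows "singular_relcycle n (nsphere n) {} (twist (Suc n) n (c n))"
proof -
  have "chain_boundary (Suc n) (c (Suc n)) = twist (Suc n) n (c n)"
    and "singular_chain (Suc n) (upper_hemisphere (Suc n)) (c (Suc n))"
    using assms by (auto simp: resolution_def)
  then have "chain_boundary n (twist (Suc n) n (c n)) = 0"
    using chain_boundary_boundary_alt by metis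
  then show ?thesis
    by (simp add: assms resolution_nsphere singular_chain_twist singular_cycle)
qed

section \<open>The top cycle is not divisible by two\<close>

text \<open>
  Divisibility by two in homology, stated for representing cycles; it replaces homology with
  coefficients modulo 2.
\<close>

definition even_class :: "nat \<Rightarrow> 'a topology \<Rightarrow> 'a chain \<Rightarrow> bool" where
  "even_class p X z \<longleftrightarrow> (\<exists>w. singular_relcycle p X {} w \<and> homologous_rel p X {} z (w + w))"

lemma even_class_homologous:
  "even_class p X z \<Longrightarrow> homologous_rel p X {} y z \<Longrightarrow> even_class p X y"
  unfolding even_class_def using homologous_rel_trans by blast

lemma even_class_add:
  assumes "even_class p X y" "even_class p X z"
  shows "even_class p X (y + z)"
proof -
  obtain v w where "singular_relcycle p X {} v" "homologous_rel p X {} y (v + v)"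
      "singular_relcycle p X {} w" "homologous_rel p X {} z (w + w)"
    using assms unfolding even_class_def by blast
  then have "singular_relcycle p X {} (v + w)" "homologous_rel p X {} (y + z) ((v + w) + (v + w))"
    using homologous_rel_add[of p X "{}" y "v + v" z "w + w"]
    by (simp_all add: singular_relcycle_add algebra_simps)
  then show ?thesis
    unfolding even_class_def by blast
qed

lemma even_class_double: "singular_relcycle p X {} w \<Longrightarrow> even_class p X (w + w)"
  unfolding even_class_def using homologous_rel_refl by blast

lemma even_class_0: "even_class p X 0"
  using even_class_double[of p X 0] by simp

text \<open>
  The number of 0-simplices, with multiplicity, that lie at the point 1 of the 0-sphere.
  It is additive and, as both ends of a path lie at the same point, vanishes on boundaries.
\<close>

definition positive_mass :: "(nat \<Rightarrow> real) chain \<Rightarrow> int" where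
  "positive_mass c = Poly_Mapping.lookup
     (frag_extend (\<lambda>f. if f (\<lambda>j. if j = 0 then 1 else 0) 0 > 0 then frag_of () else 0) c) ()"

lemma positive_mass_add: "positive_mass (a + b) = positive_mass a + positive_mass b"
  by (simp add: positive_mass_def frag_extend_add lookup_add)

lemma positive_mass_diff: "positive_mass (a - b) = positive_mass a - positive_mass b"
  by (simp add: positive_mass_def frag_extend_diff lookup_minus)

lemma positive_mass_of:
  "positive_mass (frag_of f) = (if f (\<lambda>j. if j = 0 then 1 else 0) 0 > 0 then 1 else 0)"
  by (simp add: positive_mass_def)

lemma nsphere_0_cases:
  assumes "x \<in> topspace (nsphere 0)" shows "x 0 = 1 \<or> x 0 = -1"
  using assms by (simp add: topspace_nsphere power2_eq_1_iff)

text \<open>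
  A simplex is connected, so that its image in the 0-sphere is a single point.
\<close>

lemma singular_simplex_nsphere_0_sign:
  assumes f: "singular_simplex p (nsphere 0) f"
    and "u \<in> standard_simplex p" "v \<in> standard_simplex p"
  shows "f u 0 > 0 \<longleftrightarrow> f v 0 > 0"
proof -
  let ?D = "subtopology (powertop_real UNIV) (standard_simplex p)"
  have cont: "continuous_map ?D (nsphere 0) f"
    using f by (simp add: singular_simplex_def)
  then have "continuous_map ?D euclideanreal ((\<lambda>x. x 0) \<circ> f)"
    using continuous_map_compose continuous_map_nsphere_projection by blast
  then have "connectedin euclideanreal (((\<lambda>x. x 0) \<circ> f) ` standard_simplex p)"
    using connectedin_continuous_map_image connectedin_standard_simplex
    by (metis connectedin_subtopology order_refl)
  then have conn: "is_interval ((\<lambda>x. f x 0) ` standard_simplex p)"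
    by (simp add: is_interval_connected_1 o_def)
  have range: "f x 0 = 1 \<or> f x 0 = -1" if "x \<in> standard_simplex p" for x
    using nsphere_0_cases cont that by (auto simp: continuous_map_def Pi_iff)
  have False if "a \<in> standard_simplex p" "b \<in> standard_simplex p" "f a 0 = -1" "f b 0 = 1" for a b
  proof -
    have "0 \<in> (\<lambda>x. f x 0) ` standard_simplex p"
      using mem_is_interval_1_I[OF conn imageI[OF that(1)] imageI[OF that(2)], of 0] that(3,4) by simp
    then show False
      using range by force
  qed
  then show ?thesis
    using range assms(2,3) by (metis less_numeral_extra(1) not_less_iff_gr_or_eq neg_less_0_iff_less)
qed

lemma positive_mass_boundary:
  assumes "singular_chain 1 (nsphere 0) d"
  shows "positive_mass (chain_boundary 1 d) = 0"
  using assms unfolding singular_chain_def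
proof (induction d rule: frag_induction)
  case zero
  then show ?case by (simp add: positive_mass_def)
next
  case (one f)
  let ?e = "\<lambda>j::nat. if j = 0 then 1 else (0::real)"
  have "chain_boundary 1 (frag_of f) = frag_of (singular_face 1 0 f) - frag_of (singular_face 1 1 f)"
    by (simp add: chain_boundary_of)
  moreover have "singular_face 1 k f ?e = f (simplical_face k ?e)" for k
    by (simp add: singular_face_def standard_simplex_0)
  moreover have "f (simplical_face 0 ?e) 0 > 0 \<longleftrightarrow> f (simplical_face 1 ?e) 0 > 0"
    using one by (intro singular_simplex_nsphere_0_sign[of 1] simplical_face_in_standard_simplex)
      (auto simp: standard_simplex_0)
  ultimately show ?case
    by (simp add: positive_mass_diff positive_mass_of)
next
  case (diff a b)
  then show ?case
    by (simp add: chain_boundary_diff positive_mass_diff)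
qed

lemma top_cycle_odd_0:
  assumes "resolution c"
  shows "\<not> even_class 0 (nsphere 0) (twist 1 0 (c 0))"
proof
  assume "even_class 0 (nsphere 0) (twist 1 0 (c 0))"
  then obtain w d where d: "singular_chain 1 (nsphere 0) d"
      "chain_boundary 1 d = twist 1 0 (c 0) - (w + w)"
    unfolding even_class_def homologous_rel_def singular_boundary by auto
  have "twist 1 0 (c 0) = frag_of (simplex_map 0 antipode base_point) - frag_of base_point"
    using assms by (simp add: resolution_def twist_def)
  then have "positive_mass (twist 1 0 (c 0)) = -1"
    by (simp add: positive_mass_diff positive_mass_of simplex_map_def base_point_def standard_simplex_0)
  then have "positive_mass w + positive_mass w = -1"
    using positive_mass_boundary[OF d(1)] d(2) by (simp add: positive_mass_diff positive_mass_add)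
  then show False
    by presburger
qed

text \<open>
  An isomorphism of homology groups induced by an inclusion, in terms of chains: surjectivity says
  that relative cycles can be moved into the smaller pair, injectivity that homologies can.
\<close>

lemma homology_iso_representatives:
  assumes iso: "hom_induced (int p) X S Y T id
      \<in> Group.iso (relative_homology_group p X S) (relative_homology_group p Y T)"
    and "continuous_map X Y id" "S \<subseteq> T"
  shows iso_representative: "singular_relcycle p Y T v \<Longrightarrow>
      \<exists>y. singular_relcycle p X S y \<and> homologous_rel p Y T y v"
    and iso_homologous: "\<lbrakk>singular_relcycle p X S a; singular_relcycle p X S b; homologous_rel p Y T a b\<rbrakk> \<Longrightarrow>
      homologous_rel p X S a b"
proof -
  let ?h = "hom_induced (int p) X S Y T id"
  let ?A = "relative_homology_group p X S" and ?B = "relative_homology_group p Y T"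
  have bij: "bij_betw ?h (carrier ?A) (carrier ?B)"
    using iso unfolding Group.iso_def by blast
  have h: "?h (homologous_rel_set p X S y) = homologous_rel_set p Y T y"
    if "singular_relcycle p X S y" for y
  proof -
    have "?h (homologous_rel_set p X S y) = homologous_rel_set p Y T (chain_map p id y)"
      using assms that by (intro hom_induced_chain_map) auto
    moreover have "chain_map p id y = y"
      using that by (intro chain_map_ident[of _ X]) (simp add: singular_relcycle)
    ultimately show ?thesis
      by simp
  qed
  show "\<exists>y. singular_relcycle p X S y \<and> homologous_rel p Y T y v" if "singular_relcycle p Y T v"
  proof -
    have "homologous_rel_set p Y T v \<in> carrier ?B"
      using that unfolding carrier_relative_homology_group by blast
    then have "homologous_rel_set p Y T v \<in> ?h ` carrier ?A"
      using bij_betw_imp_surj_on[OF bij] by blast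
    then obtain y where "singular_relcycle p X S y"
        "homologous_rel_set p Y T v = ?h (homologous_rel_set p X S y)"
      unfolding carrier_relative_homology_group by blast
    then show ?thesis
      using h[of y] homologous_rel_set_eq[of p Y T y v] by metis
  qed
  show "homologous_rel p X S a b"
    if a: "singular_relcycle p X S a" and b: "singular_relcycle p X S b" and "homologous_rel p Y T a b"
  proof -
    have "?h (homologous_rel_set p X S a) = ?h (homologous_rel_set p X S b)"
      unfolding h[OF a] h[OF b] homologous_rel_set_eq by fact
    moreover have "homologous_rel_set p X S a \<in> carrier ?A" "homologous_rel_set p X S b \<in> carrier ?A"
      using a b unfolding carrier_relative_homology_group by blast+
    ultimately have "homologous_rel_set p X S a = homologous_rel_set p X S b"
      using inj_onD[OF bij_betw_imp_inj_on[OF bij]] by blast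
    then show ?thesis
      unfolding homologous_rel_set_eq .
  qed
qed

text \<open>
  Relative to the lower hemisphere, the cycle on the larger sphere agrees up to sign with its part
  \<open>c (Suc n)\<close> in the upper hemisphere. Excision makes \<open>c (Suc n)\<close> twice a class of the pair formed by
  the upper hemisphere and the equator, and taking boundaries makes \<open>twist (Suc n) n (c n)\<close> twice a
  class of the equator.
\<close>

lemma top_cycle_even_descends:
  assumes c: "resolution c" and "even_class (Suc n) (nsphere (Suc n)) (twist (Suc (Suc n)) (Suc n) (c (Suc n)))"
  shows "even_class n (nsphere n) (twist (Suc n) n (c n))"
proof -
  let ?N = "Suc n"
  let ?S = "nsphere ?N"
  let ?E = "{x::nat\<Rightarrow>real. x ?N = 0}"
  let ?L = "{x::nat\<Rightarrow>real. x ?N \<le> 0}"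
  let ?s = "(-1::int) ^ Suc ?N"
  obtain w where w: "singular_relcycle ?N ?S {} w"
      "homologous_rel ?N ?S {} (twist (Suc ?N) ?N (c ?N)) (w + w)"
    using assms unfolding even_class_def by blast
  have cU: "singular_chain ?N (upper_hemisphere ?N) (c ?N)" and cS: "singular_chain ?N ?S (c ?N)"
    and bd: "chain_boundary ?N (c ?N) = twist ?N n (c n)"
    using c singular_chain_upper_hemisphere by (auto simp: resolution_def)
  \<comment> \<open>The antipode of \<open>c ?N\<close> lies in the lower hemisphere and is dropped.\<close>
  define v where "v = frag_cmul ?s w"
  have v: "singular_relcycle ?N ?S ?L v"
  proof -
    have "singular_chain ?N ?S w" "chain_boundary ?N w = 0"
      using w(1) by (simp_all add: singular_cycle)
    then show ?thesis
      unfolding v_def by (intro singular_relcycle_cmul) (simp add: singular_relcycle)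
  qed
  have rel: "homologous_rel ?N ?S ?L (c ?N) (v + v)"
  proof -
    have "continuous_map (upper_hemisphere ?N) (subtopology ?S ?L) antipode"
      unfolding upper_hemisphere_def
      by (auto simp: continuous_map_in_subtopology continuous_map_from_subtopology continuous_map_antipode)
    then have T: "singular_chain ?N (subtopology ?S ?L) (chain_map ?N antipode (c ?N))"
      using cU singular_chain_chain_map by blast
    obtain d where d: "singular_chain (Suc ?N) ?S d"
        "chain_boundary (Suc ?N) d = twist (Suc ?N) ?N (c ?N) - (w + w)"
      using w(2) unfolding homologous_rel_def singular_boundary by auto
    have "chain_boundary (Suc ?N) (frag_cmul ?s d) = frag_cmul ?s (twist (Suc ?N) ?N (c ?N) - (w + w))"
      using d by (simp add: chain_boundary_cmul)
    also have "\<dots> = frag_cmul ?s (chain_map ?N antipode (c ?N)) + (c ?N - (v + v))"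
      unfolding twist_def v_def frag_cmul_neg1_power by (auto simp: algebra_simps)
    finally have "c ?N - (v + v) = chain_boundary (Suc ?N) (frag_cmul ?s d)
        + (- frag_cmul ?s (chain_map ?N antipode (c ?N)))"
      by (metis add_diff_cancel_left' diff_conv_add_uminus)
    moreover have "singular_chain ?N (subtopology ?S ?L) (- frag_cmul ?s (chain_map ?N antipode (c ?N)))"
      using T by (metis singular_chain_cmul singular_chain_minus)
    ultimately show ?thesis
      using d(1) singular_chain_cmul unfolding homologous_rel_def singular_relboundary by metis
  qed
  \<comment> \<open>Excision replaces \<open>v\<close> by a relative cycle \<open>y\<close> of the upper hemisphere.\<close>
  have iso: "hom_induced ?N (upper_hemisphere ?N) ?E ?S ?L id
      \<in> Group.iso (relative_homology_group ?N (upper_hemisphere ?N) ?E) (relative_homology_group ?N ?S ?L)"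
    unfolding upper_hemisphere_def using iso_relative_homology_group_upper_hemisphere by blast
  have id: "continuous_map (upper_hemisphere ?N) ?S id" "?E \<subseteq> ?L"
    by (auto simp: upper_hemisphere_def continuous_map_from_subtopology)
  obtain y where y: "singular_relcycle ?N (upper_hemisphere ?N) ?E y" "homologous_rel ?N ?S ?L y v"
    using iso_representative[OF iso id v] by blast
  have "homologous_rel ?N ?S ?L (y + y) (v + v)"
    by (rule homologous_rel_add[OF y(2) y(2)])
  then have "homologous_rel ?N ?S ?L (c ?N) (y + y)"
    using rel homologous_rel_sym homologous_rel_trans by blast
  moreover have bdE: "singular_chain n (subtopology (upper_hemisphere ?N) ?E) (twist ?N n (c n))"
    unfolding upper_hemisphere_equator by (simp add: c resolution_nsphere singular_chain_twist)
  have c': "singular_relcycle ?N (upper_hemisphere ?N) ?E (c ?N)"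
    using cU bdE bd by (simp add: singular_relcycle)
  have yy: "singular_relcycle ?N (upper_hemisphere ?N) ?E (y + y)"
    using y(1) singular_relcycle_add by blast
  ultimately have "homologous_rel ?N (upper_hemisphere ?N) ?E (c ?N) (y + y)"
    using iso_homologous[OF iso id c' yy] by blast
  then obtain d e where d: "singular_chain (Suc ?N) (upper_hemisphere ?N) d"
     and e: "singular_chain ?N (subtopology (upper_hemisphere ?N) ?E) e"
     and de: "chain_boundary (Suc ?N) d + e = c ?N - (y + y)"
    unfolding homologous_rel_def singular_relboundary by blast
  \<comment> \<open>The boundary of \<open>e\<close> shows that the boundaries of \<open>c ?N\<close> and \<open>y + y\<close> are homologous on the equator.\<close>
  have "chain_boundary ?N e = chain_boundary ?N (chain_boundary (Suc ?N) d + e)"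
    using chain_boundary_boundary_alt[OF d] by (simp add: chain_boundary_add)
  then have "chain_boundary ?N e = twist ?N n (c n) - (chain_boundary ?N y + chain_boundary ?N y)"
    by (simp add: de chain_boundary_diff chain_boundary_add bd)
  moreover have "singular_chain ?N (nsphere n) e"
    using e by (simp add: upper_hemisphere_equator)
  moreover have "singular_relcycle n (nsphere n) {} (chain_boundary ?N y)"
    using y(1) chain_boundary_boundary_alt[of n "upper_hemisphere ?N" y]
    by (simp add: singular_relcycle upper_hemisphere_equator singular_chain_empty)
  ultimately show ?thesis
    unfolding even_class_def homologous_rel_def singular_boundary by blast
qed

lemma top_cycle_odd:
  assumes "resolution c"
  shows "\<not> even_class n (nsphere n) (twist (Suc n) n (c n))"
proof (induction n)
  case 0
  then show ?case using top_cycle_odd_0[OF assms] by simp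
next
  case (Suc n)
  then show ?case using top_cycle_even_descends[OF assms] by blast
qed

section \<open>Odd maps are not homotopic to even maps\<close>

lemma chain_map_antipode_homologous:
  assumes "n \<ge> 1" "singular_relcycle n (nsphere n) {} w"
  shows "homologous_rel n (nsphere n) {} (chain_map n antipode w) w \<or>
     homologous_rel n (nsphere n) {} (chain_map n antipode w) (- w)"
proof -
  let ?G = "homology_group (int n) (nsphere n)"
  have G: "reduced_homology_group (int n) (nsphere n) = ?G"
    using assms(1) by (simp add: un_reduced_homology_group)
  interpret group ?G
    by simp
  have "homeomorphic_maps (nsphere n) (nsphere n) antipode antipode"
    by (simp add: homeomorphic_maps_def continuous_map_antipode)
  then have "\<bar>Brouwer_degree2 n antipode\<bar> = 1"
    using Brouwer_degree2_homeomorphic_map homeomorphic_map_maps by blast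
  then have deg: "Brouwer_degree2 n antipode = 1 \<or> Brouwer_degree2 n antipode = -1"
    by linarith
  let ?W = "homologous_rel_set n (nsphere n) {} w"
  have W: "?W \<in> carrier ?G"
    using assms(2) by (auto simp: carrier_relative_homology_group)
  have "homologous_rel_set n (nsphere n) {} (chain_map n antipode w) =
      hom_induced n (nsphere n) {} (nsphere n) {} antipode ?W"
    by (simp add: hom_induced_chain_map continuous_map_antipode assms(2))
  also have "\<dots> = ?W [^]\<^bsub>?G\<^esub> Brouwer_degree2 n antipode"
    using Brouwer_degree2[of ?W n antipode] W G by simp
  finally have eq: "homologous_rel_set n (nsphere n) {} (chain_map n antipode w) =
      ?W [^]\<^bsub>?G\<^esub> Brouwer_degree2 n antipode" .
  have inv: "inv\<^bsub>?G\<^esub> ?W = homologous_rel_set n (nsphere n) {} (- w)"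
  proof -
    have "inv\<^bsub>?G\<^esub> ?W = uminus ` ?W"
      using inv_relative_homology_group W by blast
    then have "- w \<in> inv\<^bsub>?G\<^esub> ?W"
      by simp
    moreover obtain u where "inv\<^bsub>?G\<^esub> ?W = homologous_rel_set n (nsphere n) {} u"
      using inv_closed[OF W] by (auto simp: carrier_relative_homology_group)
    ultimately show ?thesis
      using homologous_rel_set_eq by blast
  qed
  have "homologous_rel_set n (nsphere n) {} (chain_map n antipode w) = ?W \<or>
      homologous_rel_set n (nsphere n) {} (chain_map n antipode w) = homologous_rel_set n (nsphere n) {} (- w)"
    using deg eq W inv by (auto simp: int_pow_neg int_pow_1)
  then show ?thesis
    using homologous_rel_set_eq by blast
qed

text \<open>
  The antipodal map is a homeomorphism, hence acts on the top homology of the sphere as \<open>1\<close> or \<open>-1\<close>,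
  and \<open>twist s n w\<close> is homologous to \<open>0\<close> or to \<open>w + w\<close> or \<open>- w - w\<close>.
\<close>

lemma even_class_twist:
  assumes "n \<ge> 1" "singular_relcycle n (nsphere n) {} w"
  shows "even_class n (nsphere n) (twist s n w)"
proof -
  let ?S = "nsphere n"
  have w': "singular_relcycle n ?S {} (- w)"
    using assms(2) by (simp add: singular_relcycle_minus)
  have ev: "even_class n ?S (w + w)" "even_class n ?S (- w + - w)" "even_class n ?S 0"
    using even_class_double[OF assms(2)] even_class_double[OF w'] even_class_0 by blast+
  have "homologous_rel n ?S {} (twist s n w) (x + frag_cmul ((-1) ^ s) w)"
    if "homologous_rel n ?S {} (chain_map n antipode w) x" for x
    using that homologous_rel_add[OF that homologous_rel_refl] by (simp add: twist_def)
  then show ?thesis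
    using chain_map_antipode_homologous[OF assms] ev even_class_homologous
    by (cases "even s") (fastforce simp: frag_cmul_neg1_power)+
qed

text \<open>
  An odd map commutes with the operators \<open>twist\<close>, so that \<open>c\<close> and its image under \<open>f\<close> have the same
  boundary relations. As in the comparison theorem for resolutions, a chain homotopy is built
  between them in degrees below \<open>n\<close>. In degree \<open>n\<close> it leaves a cycle as the obstruction, and the two top
  cycles differ by the twist of that cycle.
\<close>

lemma odd_map_fixes_top_cycle_mod_2:
  assumes c: "resolution c" and n: "n \<ge> 1"
    and f: "continuous_map (nsphere n) (nsphere n) f"
    and odd: "\<And>x. x \<in> topspace (nsphere n) \<Longrightarrow> f (antipode x) = antipode (f x)"
  shows "even_class n (nsphere n) (twist (Suc n) n (c n) - chain_map n f (twist (Suc n) n (c n)))"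
proof -
  let ?S = "nsphere n"
  define e where "e k = c k - chain_map k f (c k)" for k
  have cS: "singular_chain k ?S (c k)" if "k \<le> n" for k
    using c resolution_nsphere that by blast
  have eS: "singular_chain k ?S (e k)" if "k \<le> n" for k
    using cS[OF that] f by (simp add: e_def singular_chain_diff singular_chain_chain_map)
  have fS: "chain_map k f (twist s k (c k)) = twist s k (chain_map k f (c k))" if "k \<le> n" for k s
    using cS[OF that] odd by (rule chain_map_twist_odd)
  have be: "chain_boundary (Suc k) (e (Suc k)) = twist (Suc k) k (e k)" if "Suc k \<le> n" for k
  proof -
    have "chain_boundary (Suc k) (c (Suc k)) = twist (Suc k) k (c k)"
      using c by (simp add: resolution_def)
    then show ?thesis
      using chain_boundary_chain_map[OF cS[OF that], of f] fS[of k "Suc k"] that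
      by (simp add: e_def chain_boundary_diff twist_diff)
  qed
  \<comment> \<open>The chain \<open>d\<close> in degree \<open>k\<close> is the chain homotopy applied to \<open>c (k - 1)\<close>; it is 0 in degree 0, where the
     obstruction is a difference of two points and bounds because the sphere is connected.\<close>
  have ex: "\<exists>d. singular_chain k ?S d \<and> (k = 0 \<longrightarrow> d = 0) \<and> singular_relcycle k ?S {} (e k - twist k k d)"
    if "k \<le> n" for k
    using that
  proof (induction k)
    case 0
    show ?case
      by (rule exI[of _ 0]) (use eS[of 0] in \<open>simp add: singular_cycle chain_boundary_def\<close>)
  next
    case (Suc k)
    then obtain d where d: "singular_chain k ?S d" "singular_relcycle k ?S {} (e k - twist k k d)"
      and d0: "k = 0 \<Longrightarrow> d = 0"
      by auto
    have "\<exists>d'. singular_chain (Suc k) ?S d' \<and> chain_boundary (Suc k) d' = e k - twist k k d"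
    proof (cases "k = 0")
      case False
      then show ?thesis
        using cycle_bounds_nsphere[OF _ _ d(2)] Suc.prems by simp
    next
      case True
      then have "e k - twist k k d = frag_of base_point - frag_of (simplex_map 0 f base_point)"
        using c d0 by (simp add: e_def resolution_def)
      moreover have "singular_simplex 0 ?S base_point"
        using cS[of 0] c by (simp add: resolution_def singular_chain_of)
      ultimately show ?thesis
        using difference_of_points_bounds[OF path_connected_space_nsphere[OF n]] True f
        by (metis One_nat_def singular_simplex_simplex_map)
    qed
    then obtain d' where d': "singular_chain (Suc k) ?S d'" "chain_boundary (Suc k) d' = e k - twist k k d"
      by blast
    have "chain_boundary (Suc k) (e (Suc k) - twist (Suc k) (Suc k) d') = 0"
      using be[OF Suc.prems] chain_boundary_twist[OF d'(1)] d'(2) twist_twist(1)[OF d(1), of k]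
      by (simp add: chain_boundary_diff twist_diff)
    then have "singular_relcycle (Suc k) ?S {} (e (Suc k) - twist (Suc k) (Suc k) d')"
      using eS[OF Suc.prems] d'(1) by (simp add: singular_cycle singular_chain_diff singular_chain_twist)
    then show ?case
      using d'(1) by blast
  qed
  from ex[OF order_refl] obtain d where d: "singular_chain n ?S d" "singular_relcycle n ?S {} (e n - twist n n d)"
    by blast
  have "twist (Suc n) n (c n) - chain_map n f (twist (Suc n) n (c n)) = twist (Suc n) n (e n)"
    using fS[of n "Suc n"] by (simp add: e_def twist_diff)
  also have "\<dots> = twist (Suc n) n (e n - twist n n d)"
    using twist_twist(1)[OF d(1)] by (simp add: twist_diff)
  finally show ?thesis
    using even_class_twist[OF n d(2)] by simp
qed

text \<open>
  An even map identifies \<open>c\<close> with its antipode. When the two images add up, their sum is a cycle,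
  and then so is each of them because chain groups have no torsion.
\<close>

lemma even_map_kills_top_cycle_mod_2:
  assumes z: "singular_relcycle n (nsphere n) {} (twist s n c)" and c: "singular_chain n (nsphere n) c"
    and f: "continuous_map (nsphere n) (nsphere n) f"
    and even: "\<And>x. x \<in> topspace (nsphere n) \<Longrightarrow> f (antipode x) = f x"
  shows "even_class n (nsphere n) (chain_map n f (twist s n c))"
proof -
  let ?S = "nsphere n"
  let ?y = "chain_map n f c"
  have "chain_map n (f \<circ> antipode) c = ?y"
    using even by (intro chain_map_eq[OF c]) auto
  then have eq: "chain_map n f (twist s n c) = ?y + frag_cmul ((-1) ^ s) ?y"
    by (simp add: twist_def chain_map_add chain_map_compose)
  show ?thesis
  proof (cases "even s")
    case True
    have "singular_relcycle n ?S {} (?y + ?y)"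
      using singular_relcycle_chain_map[OF z f] eq True by (simp add: frag_cmul_neg1_power)
    then have "chain_boundary n ?y + chain_boundary n ?y = 0"
      by (simp add: singular_cycle chain_boundary_add)
    then have "chain_boundary n ?y = 0"
      by (intro poly_mapping_eqI) (metis add_cancel_right_left double_zero lookup_add lookup_zero)
    then have "singular_relcycle n ?S {} ?y"
      using c f by (simp add: singular_cycle singular_chain_chain_map)
    then show ?thesis
      using even_class_double eq True by (simp add: frag_cmul_neg1_power)
  qed (simp add: eq frag_cmul_neg1_power even_class_0)
qed

text \<open>
  Homotopic maps send the top cycle to homologous cycles. Its image under the even map is twice a
  class, and the odd map changes it only by twice a class, so it would itself be twice a class.
\<close>

theorem odd_map_not_homotopic_to_even_map:
  assumes n: "n \<ge> 1" and hom: "homotopic_with (\<lambda>_. True) (nsphere n) (nsphere n) f g"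
    and f: "\<And>x. x \<in> topspace (nsphere n) \<Longrightarrow> f (antipode x) = antipode (f x)"
    and g: "\<And>x. x \<in> topspace (nsphere n) \<Longrightarrow> g (antipode x) = g x"
  shows False
proof -
  let ?S = "nsphere n"
  obtain c where c: "resolution c"
    using resolution_exists by blast
  let ?z = "twist (Suc n) n (c n)"
  have cont: "continuous_map ?S ?S f" "continuous_map ?S ?S g"
    using homotopic_with_imp_continuous_maps[OF hom] by auto
  have z: "singular_relcycle n ?S {} ?z"
    by (rule resolution_cycle[OF c])
  have "homologous_rel n ?S {} (chain_map n f ?z) (chain_map n g ?z)"
    using hom z by (intro homotopic_imp_homologous_rel_chain_maps) auto
  moreover have "even_class n ?S (chain_map n g ?z)"
    using even_map_kills_top_cycle_mod_2[OF z resolution_nsphere[OF c order_refl] cont(2) g] by blast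
  ultimately have "even_class n ?S (chain_map n f ?z)"
    using even_class_homologous by blast
  then have "even_class n ?S ((?z - chain_map n f ?z) + chain_map n f ?z)"
    using odd_map_fixes_top_cycle_mod_2[OF c n cont(1) f] even_class_add by blast
  then show False
    using top_cycle_odd[OF c] by simp
qed

section \<open>Collapsing the boundary of a cube\<close>

lemma continuous_map_cube_coordinate:
  "i < k \<Longrightarrow> continuous_map (cube k) euclideanreal (\<lambda>x. x i)"
  unfolding cube_def
  using continuous_map_product_projection[of i "{..<k}" "\<lambda>_. top_of_set {0..1::real}"]
  by (simp add: continuous_map_in_subtopology)

lemma topspace_cube: "u \<in> topspace (cube k) \<longleftrightarrow> u \<in> extensional {..<k} \<and> (\<forall>i<k. 0 \<le> u i \<and> u i \<le> 1)"
  by (auto simp: cube_def PiE_def Pi_iff)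

lemma compact_space_cube: "compact_space (cube k)"
  by (simp add: cube_def compact_space_product_topology compact_space_subtopology)

text \<open>
  The distance from the centre of the cube in the maximum norm, scaled to be 1 on the boundary.
\<close>

definition sup_distance :: "nat \<Rightarrow> (nat \<Rightarrow> real) \<Rightarrow> real" where
  "sup_distance k u = Max ((\<lambda>i. \<bar>2 * u i - 1\<bar>) ` {..<k})"

lemma continuous_map_Max:
  assumes "finite I" "I \<noteq> {}" "\<And>i. i \<in> I \<Longrightarrow> continuous_map X euclideanreal (\<lambda>x. f x i)"
  shows "continuous_map X euclideanreal (\<lambda>x. Max (f x ` I))"
  using assms
proof (induction I rule: finite_ne_induct)
  case (insert i I)
  then show ?case
    by (auto intro!: continuous_map_real_max)
qed simp

text \<open>
  This identifies the sphere with the cube whose boundary is collapsed to a point. In the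
  coordinates \<open>w = 2 * u - 1\<close> the radial map \<open>w / d\<close>, with \<open>d\<close> one minus the maximum norm of \<open>w\<close>,
  stretches the open cube to the whole space; inverse stereographic projection follows. Cleared of
  denominators, the formula extends to the boundary, where \<open>d = 0\<close>, with the north pole as its value.
\<close>

definition collapse :: "nat \<Rightarrow> (nat \<Rightarrow> real) \<Rightarrow> nat \<Rightarrow> real" where
  "collapse k u =
     (let d = 1 - sup_distance k u; S = (\<Sum>i<k. (2 * u i - 1)\<^sup>2)
      in (\<lambda>i. if i < k then 2 * d * (2 * u i - 1) / (S + d\<^sup>2)
              else if i = k then (S - d\<^sup>2) / (S + d\<^sup>2) else 0))"

context
  fixes k :: nat
  assumes k: "k \<ge> 1"
begin

lemma indices_nonempty: "{..<k} \<noteq> {}"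
  using k by (metis One_nat_def Suc_le_lessD empty_iff lessThan_iff)

lemma sup_distance_ge: "i < k \<Longrightarrow> \<bar>2 * u i - 1\<bar> \<le> sup_distance k u"
  unfolding sup_distance_def by (intro Max_ge) auto

lemma sup_distance_attained: "\<exists>i<k. sup_distance k u = \<bar>2 * u i - 1\<bar>"
proof -
  have "sup_distance k u \<in> (\<lambda>i. \<bar>2 * u i - 1\<bar>) ` {..<k}"
    unfolding sup_distance_def using indices_nonempty by (intro Max_in) auto
  then show ?thesis
    by auto
qed

lemma sup_distance_le_1: "u \<in> topspace (cube k) \<Longrightarrow> sup_distance k u \<le> 1"
  using sup_distance_attained[of u] by (fastforce simp: topspace_cube abs_le_iff)

lemma sup_distance_eq_1:
  assumes "u \<in> topspace (cube k)"
  shows "sup_distance k u = 1 \<longleftrightarrow> u \<in> cube_boundary k"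
proof
  assume "sup_distance k u = 1"
  then show "u \<in> cube_boundary k"
    using sup_distance_attained[of u] assms by (auto simp: cube_boundary_def abs_if split: if_splits)
next
  assume "u \<in> cube_boundary k"
  then obtain i where "i < k" "u i = 0 \<or> u i = 1"
    by (auto simp: cube_boundary_def)
  then have "1 \<le> sup_distance k u"
    using sup_distance_ge[of i u] by auto
  then show "sup_distance k u = 1"
    using sup_distance_le_1[OF assms] by simp
qed

lemma collapse_denominator_pos: "(\<Sum>i<k. (2 * u i - 1)\<^sup>2) + (1 - sup_distance k u)\<^sup>2 > 0"
proof (rule ccontr)
  assume "\<not> ?thesis"
  then have "(\<Sum>i<k. (2 * u i - 1)\<^sup>2) = 0" "(1 - sup_distance k u)\<^sup>2 = 0"
    using sum_nonneg[of "{..<k}" "\<lambda>i. (2 * u i - 1)\<^sup>2"] zero_le_power2[of "1 - sup_distance k u"]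
    by (smt (verit) zero_le_power2)+
  then show False
    using sup_distance_attained[of u] by (auto simp: sum_nonneg_eq_0_iff)
qed

lemma collapse_in_nsphere: "collapse k u \<in> topspace (nsphere k)"
proof -
  define d S where "d = 1 - sup_distance k u" and "S = (\<Sum>i<k. (2 * u i - 1)\<^sup>2)"
  have D: "S + d\<^sup>2 > 0"
    using collapse_denominator_pos[of u] by (simp add: d_def S_def)
  have "(\<Sum>i\<le>k. (collapse k u i)\<^sup>2) =
      (\<Sum>i<k. (2 * d * (2 * u i - 1) / (S + d\<^sup>2))\<^sup>2) + ((S - d\<^sup>2) / (S + d\<^sup>2))\<^sup>2"
    by (simp add: collapse_def Let_def d_def S_def flip: lessThan_Suc_atMost)
  also have "(\<Sum>i<k. (2 * d * (2 * u i - 1) / (S + d\<^sup>2))\<^sup>2) = (2 * d / (S + d\<^sup>2))\<^sup>2 * S"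
    unfolding S_def[of] sum_distrib_left by (intro sum.cong) (simp_all add: power_mult_distrib power_divide)
  also have "(2 * d / (S + d\<^sup>2))\<^sup>2 * S + ((S - d\<^sup>2) / (S + d\<^sup>2))\<^sup>2 = (4 * d\<^sup>2 * S + (S - d\<^sup>2)\<^sup>2) / (S + d\<^sup>2)\<^sup>2"
    by (simp add: power_divide power_mult_distrib add_divide_distrib)
  also have "4 * d\<^sup>2 * S + (S - d\<^sup>2)\<^sup>2 = (S + d\<^sup>2)\<^sup>2"
    by (simp add: power2_eq_square algebra_simps)
  finally show ?thesis
    using D by (simp add: topspace_nsphere collapse_def Let_def)
qed

lemma continuous_map_collapse: "continuous_map (cube k) (nsphere k) (collapse k)"
proof -
  have d: "continuous_map (cube k) euclideanreal (sup_distance k)"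
    unfolding sup_distance_def using indices_nonempty
    by (intro continuous_map_Max continuous_intros continuous_map_cube_coordinate) auto
  have S: "continuous_map (cube k) euclideanreal (\<lambda>u. \<Sum>i<k. (2 * u i - 1)\<^sup>2)"
    by (intro continuous_intros continuous_map_cube_coordinate) auto
  have "continuous_map (cube k) euclideanreal (\<lambda>u. collapse k u i)" for i
  proof -
    have D: "(\<Sum>i<k. (2 * u i - 1)\<^sup>2) + (1 - sup_distance k u)\<^sup>2 \<noteq> 0" for u
      using collapse_denominator_pos[of u] by simp
    consider "i < k" | "i = k" | "i > k"
      by linarith
    then show ?thesis
    proof cases
      case 1
      then show ?thesis
        unfolding collapse_def Let_def
        by (simp, intro continuous_intros d S continuous_map_cube_coordinate D)
    next
      case 2
      then show ?thesis
        unfolding collapse_def Let_def by (simp, intro continuous_intros d S D)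
    qed (simp add: collapse_def Let_def)
  qed
  moreover have "collapse k \<in> topspace (cube k) \<rightarrow> {x. (\<Sum>i\<le>k. (x i)\<^sup>2) = 1 \<and> (\<forall>i>k. x i = 0)}"
    using collapse_in_nsphere by (auto simp: topspace_nsphere)
  ultimately show ?thesis
    unfolding nsphere by (simp add: continuous_map_in_subtopology continuous_map_componentwise_UNIV image_subset_iff_funcset)
qed

text \<open>
  Stereographic projection recovers \<open>w / d\<close> from the image. Since \<open>d\<close> is determined by the maximum
  norm of \<open>w\<close>, so is \<open>w\<close>.
\<close>

lemma collapse_eq_cases:
  assumes u: "u \<in> topspace (cube k)" and v: "v \<in> topspace (cube k)" and eq: "collapse k u = collapse k v"
  shows "u = v \<or> u \<in> cube_boundary k \<and> v \<in> cube_boundary k"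
proof -
  define d S where "d u = 1 - sup_distance k u" and "S u = (\<Sum>i<k. (2 * u i - 1)\<^sup>2)" for u
  have D: "S u + (d u)\<^sup>2 > 0" for u
    using collapse_denominator_pos[of u] by (simp add: d_def S_def)
  have last: "1 - collapse k u k = 2 * (d u)\<^sup>2 / (S u + (d u)\<^sup>2)" for u
  proof -
    have "collapse k u k = (S u - (d u)\<^sup>2) / (S u + (d u)\<^sup>2)"
      by (simp add: collapse_def Let_def flip: d_def S_def)
    then show ?thesis
      using D[of u] by (simp add: field_simps)
  qed
  have coord: "collapse k u i = 2 * d u * (2 * u i - 1) / (S u + (d u)\<^sup>2)" if "i < k" for u i
    using that by (simp add: collapse_def Let_def flip: d_def S_def)
  have bd: "d w = 0 \<longleftrightarrow> w \<in> cube_boundary k" if "w \<in> topspace (cube k)" for w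
    using sup_distance_eq_1[OF that] by (auto simp: d_def)
  have zero: "1 - collapse k w k = 0 \<longleftrightarrow> d w = 0" for w
    using D[of w] unfolding last by auto
  show ?thesis
  proof (cases "d u = 0")
    case True
    then have "d v = 0"
      using zero eq by metis
    then show ?thesis
      using True bd u v by blast
  next
    case False
    then have dv: "d v \<noteq> 0"
      using zero eq by metis
    have pos: "d u > 0" "d v > 0"
      using False dv sup_distance_le_1[OF u] sup_distance_le_1[OF v] by (auto simp: d_def)
    have ratio: "collapse k w i / (1 - collapse k w k) = (2 * w i - 1) / d w"
      if "i < k" "d w > 0" for w i
    proof -
      have "(2 * b * a / c) / (2 * b\<^sup>2 / c) = a / b" if "b > 0" "c > 0" for a b c :: real
        using that by (simp add: field_simps power2_eq_square)
      then show ?thesis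
        using that D[of w] unfolding last coord[OF that(1)] by blast
    qed
    have proportional: "(2 * u i - 1) * d v = (2 * v i - 1) * d u" if "i < k" for i
      using ratio[OF that pos(1)] ratio[OF that pos(2)] eq pos by (simp add: field_simps)
    have "sup_distance k u * d v \<le> sup_distance k v * d u"
      if "\<And>i. i < k \<Longrightarrow> (2 * u i - 1) * d v = (2 * v i - 1) * d u" "d u > 0" "d v > 0" for u v
    proof -
      obtain i where i: "i < k" "sup_distance k u = \<bar>2 * u i - 1\<bar>"
        using sup_distance_attained by blast
      have "\<bar>2 * u i - 1\<bar> * d v = \<bar>2 * v i - 1\<bar> * d u"
        using that(1)[OF i(1)] that(2,3) by (metis abs_mult abs_of_pos)
      then show ?thesis
        using i sup_distance_ge[OF i(1), of v] that(2) by (simp add: mult_right_mono)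
    qed
    from this[of u v] this[of v u] have "sup_distance k u * d v = sup_distance k v * d u"
      using proportional pos by fastforce
    then have "sup_distance k u = sup_distance k v"
      by (simp add: d_def algebra_simps)
    then have "d u = d v"
      by (simp add: d_def)
    then have "u i = v i" if "i < k" for i
      using proportional[OF that] pos by simp
    then have "u = v"
      using u v by (intro extensionalityI[of u "{..<k}" v]) (auto simp: topspace_cube)
    then show ?thesis ..
  qed
qed

text \<open>
  For a point other than the north pole, with stereographic image \<open>y\<close> of maximum norm \<open>N\<close>, the
  preimage is \<open>w = y / (1 + N)\<close>, for which \<open>d = 1 / (1 + N)\<close>.
\<close>

lemma collapse_surjective:
  assumes s: "s \<in> topspace (nsphere k)"
  shows "\<exists>u \<in> topspace (cube k). collapse k u = s"
proof -
  have s1: "(\<Sum>i<k. (s i)\<^sup>2) + (s k)\<^sup>2 = 1" and s0: "\<And>i. i > k \<Longrightarrow> s i = 0"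
    using s by (auto simp: topspace_nsphere simp flip: lessThan_Suc_atMost)
  show ?thesis
  proof (cases "s k = 1")
    case True
    define u where "u = restrict (\<lambda>_. 1::real) {..<k}"
    have u: "u \<in> topspace (cube k)"
      by (auto simp: u_def topspace_cube)
    have "u \<in> cube_boundary k"
      using u k by (auto simp: cube_boundary_def u_def intro!: exI[of _ 0])
    then have "sup_distance k u = 1"
      using sup_distance_eq_1[OF u] by simp
    moreover have "(\<Sum>i<k. (2 * u i - 1)\<^sup>2) = real k"
      by (simp add: u_def)
    moreover have "s i = 0" if "i < k" for i
    proof -
      have "(\<Sum>i<k. (s i)\<^sup>2) = 0"
        using s1 True by simp
      then show ?thesis
        using that by (simp add: sum_nonneg_eq_0_iff)
    qed
    ultimately have "collapse k u = s"
      using k True s0 by (auto simp: collapse_def Let_def fun_eq_iff)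
    then show ?thesis
      using u by blast
  next
    case False
    have "s k \<le> 1"
      using s1 sum_nonneg[of "{..<k}" "\<lambda>i. (s i)\<^sup>2"] by (metis abs_le_square_iff abs_le_D1 abs_one le_add_same_cancel2 one_power2 zero_le_power2)
    then have pos: "1 - s k > 0"
      using False by simp
    define y where "y i = s i / (1 - s k)" for i
    define N where "N = Max ((\<lambda>i. \<bar>y i\<bar>) ` {..<k})"
    have Nge: "\<bar>y i\<bar> \<le> N" if "i < k" for i
      unfolding N_def using that by (intro Max_ge) auto
    have Nin: "N \<in> (\<lambda>i. \<bar>y i\<bar>) ` {..<k}"
      unfolding N_def using indices_nonempty by (intro Max_in) auto
    have N0: "0 \<le> N"
      using Nin by auto
    define u where "u = restrict (\<lambda>i. (y i / (1 + N) + 1) / 2) {..<k}"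
    have w: "2 * u i - 1 = y i / (1 + N)" if "i < k" for i
    proof -
      have "2 * ((a + 1) / 2) - 1 = a" for a :: real
        by (simp add: field_simps)
      then show ?thesis
        using that by (simp only: u_def restrict_apply lessThan_iff if_True)
    qed
    have u: "u \<in> topspace (cube k)"
    proof -
      have "\<bar>y i / (1 + N)\<bar> \<le> 1" if "i < k" for i
        using Nge[OF that] N0 by (simp add: field_simps)
      then show ?thesis
        by (fastforce simp: topspace_cube u_def abs_le_iff simp del: abs_divide)
    qed
    have d: "1 - sup_distance k u = 1 / (1 + N)"
    proof -
      have "(\<lambda>i. \<bar>2 * u i - 1\<bar>) ` {..<k} = (\<lambda>t. t / (1 + N)) ` ((\<lambda>i. \<bar>y i\<bar>) ` {..<k})"
        using N0 by (auto simp: w image_image)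
      moreover have "Max ((\<lambda>t. t / (1 + N)) ` ((\<lambda>i. \<bar>y i\<bar>) ` {..<k})) = N / (1 + N)"
        unfolding N_def using indices_nonempty N0[unfolded N_def]
        by (intro mono_Max_commute[symmetric]) (auto simp: mono_def divide_right_mono)
      ultimately have "sup_distance k u = N / (1 + N)"
        by (simp add: sup_distance_def)
      then show ?thesis
        using N0 by (simp add: field_simps)
    qed
    define Y where "Y = (\<Sum>i<k. (y i)\<^sup>2)"
    have "Y = (1 - (s k)\<^sup>2) / (1 - s k)\<^sup>2"
      using s1 by (simp add: Y_def y_def power_divide flip: sum_divide_distrib)
    moreover have "1 - (s k)\<^sup>2 = (1 + s k) * (1 - s k)"
      by (simp add: power2_eq_square algebra_simps)
    ultimately have Y: "Y * (1 - s k) = 1 + s k"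
      using pos by (simp add: power2_eq_square)
    have S: "(\<Sum>i<k. (2 * u i - 1)\<^sup>2) = Y / (1 + N)\<^sup>2"
      by (simp add: w Y_def power_divide flip: sum_divide_distrib)
    have Y0: "Y \<ge> 0"
      by (simp add: Y_def sum_nonneg)
    have N1: "1 + N > 0"
      using N0 by simp
    have D: "(\<Sum>i<k. (2 * u i - 1)\<^sup>2) + (1 - sup_distance k u)\<^sup>2 = (Y + 1) / (1 + N)\<^sup>2"
      by (simp add: S d power_divide add_divide_distrib)
    have "collapse k u i = s i" for i
    proof -
      consider "i < k" | "i = k" | "i > k"
        by linarith
      then show ?thesis
      proof cases
        case 1
        have "collapse k u i = 2 * (1 / (1 + N)) * (y i / (1 + N)) / ((Y + 1) / (1 + N)\<^sup>2)"
          using 1 w[OF 1] D d by (simp add: collapse_def Let_def)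
        also have "\<dots> = 2 * y i / (Y + 1)"
          using N1 Y0 by (simp add: power2_eq_square)
        also have "\<dots> = s i"
        proof -
          have "(Y + 1) * (1 - s k) = 2"
            using Y by (simp add: algebra_simps)
          moreover have "s i = y i * (1 - s k)"
            using pos by (simp add: y_def)
          ultimately have "2 * y i = s i * (Y + 1)"
            by (simp add: mult.commute)
          then show ?thesis
            using Y0 by simp
        qed
        finally show ?thesis .
      next
        case 2
        have "collapse k u k = (Y / (1 + N)\<^sup>2 - (1 / (1 + N))\<^sup>2) / ((Y + 1) / (1 + N)\<^sup>2)"
          using D d S by (simp add: collapse_def Let_def)
        also have "\<dots> = ((Y - 1) / (1 + N)\<^sup>2) / ((Y + 1) / (1 + N)\<^sup>2)"
          by (simp add: power_divide diff_divide_distrib)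
        also have "\<dots> = (Y - 1) / (Y + 1)"
          using N1 by simp
        also have "\<dots> = s k"
          using Y Y0 by (simp add: field_simps)
        finally show ?thesis
          using 2 by simp
      next
        case 3
        then show ?thesis
          using s0 by (simp add: collapse_def Let_def)
      qed
    qed
    then show ?thesis
      using u by blast
  qed
qed

end


section \<open>Equivariant maps from spheres\<close>

lemma homotopic_rel_boundary_if_singleton:
  assumes sing: "is_singleton (homotopy_group_carrier k X x0)"
    and f: "continuous_map (cube k) X f" "\<And>x. x \<in> cube_boundary k \<Longrightarrow> f x = x0"
    and g: "continuous_map (cube k) X g" "\<And>x. x \<in> cube_boundary k \<Longrightarrow> g x = x0"
  shows "homotopic_rel_boundary k X x0 f g"
proof -
  let ?A = "{f. continuous_map (cube k) X f \<and> (\<forall>x \<in> cube_boundary k. f x = x0)}"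
  let ?R = "{(f, g). homotopic_rel_boundary k X x0 f g}"
  have "f \<in> ?A" "g \<in> ?A"
    using f g by auto
  then have "?R `` {f} \<in> ?A // ?R" "?R `` {g} \<in> ?A // ?R"
    by (simp_all only: quotientI)
  then have "?R `` {f} = ?R `` {g}"
    using sing unfolding homotopy_group_carrier_def is_singleton_def by fastforce
  moreover have "homotopic_rel_boundary k X x0 g g"
    using g by (simp add: homotopic_rel_boundary_def)
  ultimately show ?thesis
    by blast
qed

lemma homotopy_on_cube:
  assumes "is_singleton (homotopy_group_carrier k X x0)"
    and "continuous_map (cube k) X f" "\<And>x. x \<in> cube_boundary k \<Longrightarrow> f x = x0"
    and "continuous_map (cube k) X g" "\<And>x. x \<in> cube_boundary k \<Longrightarrow> g x = x0"
  obtains h where "continuous_map (prod_topology (top_of_set {0..1::real}) (cube k)) X h"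
    "\<And>x. h (0, x) = f x" "\<And>x. h (1, x) = g x"
    "\<And>t x. t \<in> {0..1} \<Longrightarrow> x \<in> cube_boundary k \<Longrightarrow> h (t, x) = x0"
  using homotopic_rel_boundary_if_singleton[OF assms]
  unfolding homotopic_rel_boundary_def homotopic_with_def by auto

lemma topspace_upper_hemisphere: "x \<in> topspace (upper_hemisphere n) \<longleftrightarrow> x \<in> topspace (nsphere n) \<and> 0 \<le> x n"
  by (simp add: upper_hemisphere_def)

lemma nsphere_equator_iff: "x \<in> topspace (nsphere k) \<longleftrightarrow> x \<in> topspace (nsphere (Suc k)) \<and> x (Suc k) = 0"
proof -
  have "topspace (nsphere k) = topspace (subtopology (nsphere (Suc k)) {x. x (Suc k) = 0})"
    by (simp only: subtopology_nsphere_equator)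
  then show ?thesis
    by simp
qed

text \<open>
  The point of latitude \<open>t\<close> above the point \<open>s\<close> of the equator. At latitude 1 it is the pole, whatever \<open>s\<close> is.
\<close>

definition suspend :: "nat \<Rightarrow> (nat \<Rightarrow> real) \<Rightarrow> real \<Rightarrow> nat \<Rightarrow> real" where
  "suspend k s t = (\<lambda>i. if i = Suc k then t else sqrt (1 - t\<^sup>2) * s i)"

lemma suspend_in_upper_hemisphere:
  assumes "s \<in> topspace (nsphere k)" "t \<in> {0..1}"
  shows "suspend k s t \<in> topspace (upper_hemisphere (Suc k))"
proof -
  have "(\<Sum>i\<le>k. (suspend k s t i)\<^sup>2) = (1 - t\<^sup>2) * (\<Sum>i\<le>k. (s i)\<^sup>2)"
    unfolding sum_distrib_left using assms(2)
    by (intro sum.cong) (auto simp: suspend_def power_mult_distrib abs_square_le_1)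
  then show ?thesis
    using assms by (auto simp: topspace_upper_hemisphere topspace_nsphere suspend_def)
qed

lemma suspend_surjective:
  assumes x: "x \<in> topspace (upper_hemisphere (Suc k))"
  shows "\<exists>s \<in> topspace (nsphere k). \<exists>t \<in> {0..1}. suspend k s t = x"
proof -
  define t where "t = x (Suc k)"
  have sum: "(\<Sum>i\<le>k. (x i)\<^sup>2) + t\<^sup>2 = 1" and x0: "\<And>i. i > Suc k \<Longrightarrow> x i = 0" and t0: "0 \<le> t"
    using x by (auto simp: topspace_upper_hemisphere topspace_nsphere t_def)
  have "t\<^sup>2 \<le> 1"
    using sum sum_nonneg[of "{..k}" "\<lambda>i. (x i)\<^sup>2"] by simp
  then have t: "t \<in> {0..1}"
    using t0 by (simp add: abs_square_le_1)
  show ?thesis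
  proof (cases "t = 1")
    case True
    then have "(\<Sum>i\<le>k. (x i)\<^sup>2) = 0"
      using sum by simp
    then have "x i = 0" if "i \<le> k" for i
      using that by (simp add: sum_nonneg_eq_0_iff)
    then have "x i = 0" if "i \<noteq> Suc k" for i
      using that x0 by (metis le_SucE linorder_not_le)
    then have "suspend k (\<lambda>i. if i = 0 then 1 else 0) 1 = x"
      using True by (auto simp: suspend_def t_def)
    then show ?thesis
      using in_topspace_nsphere[of k] by force
  next
    case False
    then have "t\<^sup>2 < 1"
      using t by (simp add: abs_square_less_1)
    then have r: "sqrt (1 - t\<^sup>2) > 0"
      by simp
    define s where "s i = (if i = Suc k then 0 else x i / sqrt (1 - t\<^sup>2))" for i
    have "(\<Sum>i\<le>k. (s i)\<^sup>2) = (\<Sum>i\<le>k. (x i)\<^sup>2 / (1 - t\<^sup>2))"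
      using \<open>t\<^sup>2 < 1\<close> by (intro sum.cong) (auto simp: s_def power_divide)
    also have "\<dots> = (\<Sum>i\<le>k. (x i)\<^sup>2) / (1 - t\<^sup>2)"
      by (simp add: sum_divide_distrib)
    also have "\<dots> = 1"
      using sum \<open>t\<^sup>2 < 1\<close> by (simp add: field_simps)
    finally have "s \<in> topspace (nsphere k)"
      using x0 by (auto simp: topspace_nsphere s_def)
    moreover have "suspend k s t = x"
      using r by (auto simp: suspend_def s_def t_def)
    ultimately show ?thesis
      using t by blast
  qed
qed

text \<open>
  Precomposing \<open>g\<close> with \<open>collapse k\<close> gives an element of the homotopy group, so there is a homotopy
  \<open>h\<close> on the cube from it to a constant map. As \<open>h\<close> is constant on the boundary of the cube and at
  time 1, it factors through the quotient map that uses the time as the latitude. The 0-cube has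
  empty boundary and does not cover the 0-sphere; there \<open>h\<close> is a path between the two values of \<open>g\<close>.
\<close>

lemma extend_over_upper_hemisphere:
  assumes triv: "\<And>x0. x0 \<in> topspace X \<Longrightarrow> is_singleton (homotopy_group_carrier k X x0)"
    and g: "continuous_map (nsphere k) X g"
  obtains g' where "continuous_map (upper_hemisphere (Suc k)) X g'"
    "\<And>x. x \<in> topspace (nsphere k) \<Longrightarrow> g' x = g x"
proof (cases "k = 0")
  case True
  define e where "e = (\<lambda>i::nat. if i = 0 then 1 else (0::real))"
  have e: "e \<in> topspace (nsphere 0)"
    unfolding e_def by (rule in_topspace_nsphere)
  then have e': "antipode e \<in> topspace (nsphere 0)"
    by simp
  have gX: "g e \<in> topspace X" "g (antipode e) \<in> topspace X"
    using g e e' True by (auto simp: continuous_map_def Pi_iff simp del: antipode_in_nsphere)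
  obtain h where h: "continuous_map (prod_topology (top_of_set {0..1::real}) (cube 0)) X h"
    "\<And>x. h (0, x) = g e" "\<And>x. h (1, x) = g (antipode e)"
    using homotopy_on_cube[of 0 X "g e" "\<lambda>_. g e" "\<lambda>_. g (antipode e)"] triv gX True
    by (auto simp: cube_boundary_def)
  have p: "continuous_map (upper_hemisphere 1) (top_of_set {0..1::real}) (\<lambda>x. (1 - x 0) / 2)"
  proof -
    have "continuous_map (upper_hemisphere 1) euclideanreal (\<lambda>x. (1 - x 0) / 2)"
      unfolding upper_hemisphere_def
      by (intro continuous_intros continuous_map_from_subtopology continuous_map_nsphere_projection) auto
    moreover have "-1 \<le> x 0 \<and> x 0 \<le> 1" if "x \<in> topspace (upper_hemisphere 1)" for x
    proof -
      have "(x 0)\<^sup>2 \<le> 1"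
      proof -
        have "(x 0)\<^sup>2 + (x (Suc 0))\<^sup>2 = 1"
          using that by (simp add: topspace_upper_hemisphere topspace_nsphere)
        then show ?thesis
          by (smt (verit) zero_le_power2)
      qed
      then show ?thesis
        by (simp add: abs_square_le_1 abs_le_iff)
    qed
    ultimately show ?thesis
      by (auto simp: continuous_map_in_subtopology)
  qed
  have "continuous_map (upper_hemisphere 1) (cube 0) (\<lambda>_. \<lambda>_. undefined)"
    by (simp add: cube_def)
  then have "continuous_map (upper_hemisphere 1) X (h \<circ> (\<lambda>x. ((1 - x 0) / 2, \<lambda>_. undefined)))"
    using p h(1) by (intro continuous_map_compose[OF _ h(1)]) (simp add: continuous_map_paired)
  moreover have "(h \<circ> (\<lambda>x. ((1 - x 0) / 2, \<lambda>_. undefined))) x = g x" if "x \<in> topspace (nsphere 0)" for x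
  proof -
    have "x = e \<or> x = antipode e"
      using that by (auto simp: topspace_nsphere e_def fun_eq_iff power2_eq_1_iff)
    then show ?thesis
      using h(2,3) by (auto simp: e_def)
  qed
  ultimately show ?thesis
    using that True by simp
next
  case False
  then have k: "k \<ge> 1"
    by simp
  let ?I = "top_of_set {0..1::real}"
  let ?P = "prod_topology ?I (cube k)"
  define x0 where "x0 = g (collapse k (restrict (\<lambda>_. 0) {..<k}))"
  have corner: "restrict (\<lambda>_. 0::real) {..<k} \<in> topspace (cube k)"
    "restrict (\<lambda>_. 0::real) {..<k} \<in> cube_boundary k"
    using k by (auto simp: topspace_cube cube_boundary_def intro!: exI[of _ 0])
  have gq: "continuous_map (cube k) X (g \<circ> collapse k)"
    using continuous_map_compose[OF continuous_map_collapse[OF k] g] .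
  have x0: "x0 \<in> topspace X"
    using gq corner by (auto simp: x0_def continuous_map_def Pi_iff)
  have boundary: "collapse k u = collapse k v" if "u \<in> cube_boundary k" "v \<in> cube_boundary k" for u v
  proof -
    have "sup_distance k u = 1" "sup_distance k v = 1" "u \<in> topspace (cube k)" "v \<in> topspace (cube k)"
      using that sup_distance_eq_1[OF k] by (auto simp: cube_boundary_def)
    then show ?thesis
      using collapse_denominator_pos[OF k, of u] collapse_denominator_pos[OF k, of v]
      by (auto simp: collapse_def Let_def fun_eq_iff)
  qed
  obtain h where h: "continuous_map ?P X h"
    "\<And>u. h (0, u) = (g \<circ> collapse k) u" "\<And>u. h (1, u) = x0"
    "\<And>t u. t \<in> {0..1} \<Longrightarrow> u \<in> cube_boundary k \<Longrightarrow> h (t, u) = x0"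
  proof (rule homotopy_on_cube[OF triv[OF x0] gq])
    show "(g \<circ> collapse k) u = x0" if "u \<in> cube_boundary k" for u
      using boundary[OF that corner(2)] by (simp add: x0_def)
    show "continuous_map (cube k) X (\<lambda>_. x0)"
      using x0 by simp
  qed (rule refl, rule that)
  define Q where "Q = (\<lambda>(t, u). suspend k (collapse k u) t)"
  have contQ: "continuous_map ?P (upper_hemisphere (Suc k)) Q"
  proof -
    have c: "continuous_map ?P euclideanreal (\<lambda>p. collapse k (snd p) i)" for i
      using continuous_map_compose[OF continuous_map_snd continuous_map_compose[OF continuous_map_collapse[OF k]
          continuous_map_nsphere_projection]] by (simp add: o_def)
    have t: "continuous_map ?P euclideanreal fst"
      using continuous_map_fst[of ?I "cube k"] by (auto simp: continuous_map_in_subtopology)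
    have "continuous_map ?P euclideanreal (\<lambda>p. Q p i)" for i
      unfolding Q_def suspend_def case_prod_unfold
      by (cases "i = Suc k") (auto intro!: continuous_intros c t)
    moreover have "Q p \<in> topspace (upper_hemisphere (Suc k))" if "p \<in> topspace ?P" for p
      using that collapse_in_nsphere[OF k] suspend_in_upper_hemisphere by (auto simp: Q_def)
    ultimately show ?thesis
      unfolding upper_hemisphere_def nsphere
      by (auto simp: continuous_map_in_subtopology continuous_map_componentwise_UNIV upper_hemisphere_def nsphere)
  qed
  have quot: "quotient_map ?P (upper_hemisphere (Suc k)) Q"
  proof (rule continuous_imp_quotient_map[OF contQ])
    show "compact_space ?P"
      by (simp add: compact_space_prod_topology compact_space_cube compact_space_subtopology)
    have "Hausdorff_space (powertop_real (UNIV :: nat set))"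
      by (simp add: Hausdorff_space_product_topology)
    then show "Hausdorff_space (upper_hemisphere (Suc k))"
      by (simp add: upper_hemisphere_def nsphere Hausdorff_space_subtopology)
    have "x \<in> Q ` topspace ?P" if x: "x \<in> topspace (upper_hemisphere (Suc k))" for x
    proof -
      obtain s t where s: "s \<in> topspace (nsphere k)" and t: "t \<in> {0..1}" "suspend k s t = x"
        using suspend_surjective[OF x] by blast
      obtain u where "u \<in> topspace (cube k)" "collapse k u = s"
        using collapse_surjective[OF k s] by blast
      then show ?thesis
        using t by (intro image_eqI[of _ _ "(t, u)"]) (auto simp: Q_def)
    qed
    then show "Q ` topspace ?P = topspace (upper_hemisphere (Suc k))"
      using contQ by (auto simp: continuous_map_def Pi_iff)
  qed
  have "h p = h p'" if p: "p \<in> topspace ?P" and p': "p' \<in> topspace ?P" and eq: "Q p = Q p'" for p p'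
  proof -
    obtain t u t' u' where tu: "p = (t, u)" "p' = (t', u')"
      by (metis surj_pair)
    have t: "t = t'" "t \<in> {0..1}"
      using fun_cong[OF eq, of "Suc k"] p tu by (auto simp: Q_def suspend_def)
    show ?thesis
    proof (cases "t = 1")
      case False
      then have "t\<^sup>2 < 1"
        using t by (simp add: abs_square_less_1)
      then have "collapse k u i = collapse k u' i" for i
        using fun_cong[OF eq, of i] collapse_in_nsphere[OF k, of u] collapse_in_nsphere[OF k, of u'] t tu
        by (cases "i = Suc k") (auto simp: Q_def suspend_def topspace_nsphere)
      then have "u = u' \<or> u \<in> cube_boundary k \<and> u' \<in> cube_boundary k"
        using p p' tu by (intro collapse_eq_cases[OF k]) auto
      then show ?thesis
        using h(4) t tu by auto
    qed (use h(3) t tu in simp)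
  qed
  then obtain g' where g': "continuous_map (upper_hemisphere (Suc k)) X g'"
      "\<And>p. p \<in> topspace ?P \<Longrightarrow> g' (Q p) = h p"
    using quotient_map_lift_exists[OF quot h(1)] by metis
  have "g' x = g x" if x: "x \<in> topspace (nsphere k)" for x
  proof -
    obtain u where u: "u \<in> topspace (cube k)" "collapse k u = x"
      using collapse_surjective[OF k x] by blast
    have "x (Suc k) = 0"
      using x by (simp add: topspace_nsphere)
    then have "Q (0, u) = x"
      using u by (auto simp: Q_def suspend_def)
    then show ?thesis
      using g'(2)[of "(0, u)"] h(2) u by auto
  qed
  then show ?thesis
    using that g'(1) by blast
qed

text \<open>
  By induction on the dimension: an extension of the map on the equator over the upper hemisphere
  determines the values on the lower hemisphere by equivariance, and on the equator the two
  definitions agree.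
\<close>

theorem equivariant_map_from_sphere:
  assumes triv: "\<And>k x0. k < n \<Longrightarrow> x0 \<in> topspace X \<Longrightarrow> is_singleton (homotopy_group_carrier k X x0)"
    and ne: "topspace X \<noteq> {}"
    and \<sigma>: "continuous_map X X \<sigma>" "\<And>p. p \<in> topspace X \<Longrightarrow> \<sigma> (\<sigma> p) = p"
  shows "\<exists>s. continuous_map (nsphere n) X s \<and> (\<forall>x \<in> topspace (nsphere n). s (antipode x) = \<sigma> (s x))"
  using triv
proof (induction n)
  case 0
  obtain p where p: "p \<in> topspace X"
    using ne by blast
  then have p': "\<sigma> p \<in> topspace X"
    using \<sigma>(1) by (auto simp: continuous_map_def Pi_iff)
  define s where "s = (\<lambda>x::nat\<Rightarrow>real. if 0 \<le> x 0 then p else \<sigma> p)"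
  have "continuous_map (nsphere 0) X s"
    unfolding s_def
  proof (intro continuous_map_cases_le continuous_map_nsphere_projection)
    show "p = \<sigma> p" if "x \<in> topspace (nsphere 0)" "0 = x 0" for x
      using nsphere_0_cases[OF that(1)] that(2) by simp
  qed (use p p' in auto)
  moreover have "s (antipode x) = \<sigma> (s x)" if "x \<in> topspace (nsphere 0)" for x
    using nsphere_0_cases[OF that] \<sigma>(2)[OF p] by (auto simp: s_def)
  ultimately show ?case
    by blast
next
  case (Suc k)
  then obtain g where g: "continuous_map (nsphere k) X g"
      "\<And>x. x \<in> topspace (nsphere k) \<Longrightarrow> g (antipode x) = \<sigma> (g x)"
    by (metis less_SucI)
  obtain g' where g': "continuous_map (upper_hemisphere (Suc k)) X g'"
      "\<And>x. x \<in> topspace (nsphere k) \<Longrightarrow> g' x = g x"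
    using extend_over_upper_hemisphere[of X k g] Suc.prems g(1) by blast
  define s where "s x = (if 0 \<le> x (Suc k) then g' x else \<sigma> (g' (antipode x)))" for x
  have *: "\<sigma> (g' (antipode x)) = g' x" if "x \<in> topspace (nsphere (Suc k))" "x (Suc k) = 0" for x
  proof -
    have x: "x \<in> topspace (nsphere k)"
      using that nsphere_equator_iff by blast
    then have "g x \<in> topspace X"
      using g(1) by (auto simp: continuous_map_def Pi_iff)
    then show ?thesis
      using x g'(2) g(2) \<sigma>(2) by simp
  qed
  have "continuous_map (nsphere (Suc k)) X s"
    unfolding s_def
  proof (rule continuous_map_cases_le)
    show "continuous_map (subtopology (nsphere (Suc k)) {x \<in> topspace (nsphere (Suc k)). 0 \<le> x (Suc k)}) X g'"
    proof -
      have "{x \<in> topspace (nsphere (Suc k)). 0 \<le> x (Suc k)} = topspace (nsphere (Suc k)) \<inter> {x. 0 \<le> x (Suc k)}"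
        by auto
      then show ?thesis
        using g'(1) by (simp only: upper_hemisphere_def subtopology_restrict)
    qed
    have "continuous_map (subtopology (nsphere (Suc k)) {x \<in> topspace (nsphere (Suc k)). x (Suc k) \<le> 0})
        (upper_hemisphere (Suc k)) antipode"
      unfolding upper_hemisphere_def
      by (auto simp: continuous_map_in_subtopology continuous_map_from_subtopology continuous_map_antipode)
    then have "continuous_map (subtopology (nsphere (Suc k)) {x \<in> topspace (nsphere (Suc k)). x (Suc k) \<le> 0})
        X (\<sigma> \<circ> (g' \<circ> antipode))"
      using g'(1) \<sigma>(1) by (intro continuous_map_compose)
    then show "continuous_map (subtopology (nsphere (Suc k)) {x \<in> topspace (nsphere (Suc k)). x (Suc k) \<le> 0})
        X (\<lambda>x. \<sigma> (g' (antipode x)))"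
      by (simp add: o_def)
  qed (use * in \<open>auto intro: continuous_map_nsphere_projection\<close>)
  moreover have "s (antipode x) = \<sigma> (s x)" if x: "x \<in> topspace (nsphere (Suc k))" for x
  proof -
    have in_X: "g' y \<in> topspace X" if "y \<in> topspace (nsphere (Suc k))" "0 \<le> y (Suc k)" for y
      using g'(1) that by (auto simp: continuous_map_def Pi_iff topspace_upper_hemisphere)
    consider "x (Suc k) = 0" | "x (Suc k) > 0" | "x (Suc k) < 0"
      by linarith
    then show ?thesis
    proof cases
      case 1
      then show ?thesis
        using *[OF x] *[of "antipode x"] x by (simp add: s_def)
    next
      case 2
      then show ?thesis
        by (simp add: s_def)
    next
      case 3
      then show ?thesis
        using in_X[of "antipode x"] x \<sigma>(2) by (simp add: s_def)
    qed
  qed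
  ultimately show ?case
    by blast
qed

section \<open>The Hom complex and colour masses\<close>

lemma topspace_hom_complex:
  "topspace (hom_complex H G) = (\<Union>\<eta> \<in> hom_cells H G. topspace (cell_topology (pverts H) \<eta>))"
proof
  show "topspace (hom_complex H G) \<subseteq> (\<Union>\<eta> \<in> hom_cells H G. topspace (cell_topology (pverts H) \<eta>))"
    using openin_hom_complex[of H G "topspace (hom_complex H G)"] by simp
  let ?U = "\<Union>\<eta> \<in> hom_cells H G. topspace (cell_topology (pverts H) \<eta>)"
  have "openin (cell_topology (pverts H) \<eta>) (?U \<inter> topspace (cell_topology (pverts H) \<eta>))"
    if "\<eta> \<in> hom_cells H G" for \<eta>
  proof -
    have "?U \<inter> topspace (cell_topology (pverts H) \<eta>) = topspace (cell_topology (pverts H) \<eta>)"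
      using that by blast
    then show ?thesis
      by simp
  qed
  then have "openin (hom_complex H G) ?U"
    by (simp add: openin_hom_complex)
  then show "?U \<subseteq> topspace (hom_complex H G)"
    by (rule openin_subset)
qed

lemma continuous_map_cell_inclusion:
  "\<eta> \<in> hom_cells H G \<Longrightarrow> continuous_map (cell_topology (pverts H) \<eta>) (hom_complex H G) id"
  unfolding continuous_map_def
proof (intro conjI allI impI)
  assume \<eta>: "\<eta> \<in> hom_cells H G"
  then show "id \<in> topspace (cell_topology (pverts H) \<eta>) \<rightarrow> topspace (hom_complex H G)"
    unfolding topspace_hom_complex by auto
  fix U
  assume "openin (hom_complex H G) U"
  then have "openin (cell_topology (pverts H) \<eta>) (U \<inter> topspace (cell_topology (pverts H) \<eta>))"
    using \<eta> by (simp add: openin_hom_complex)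
  moreover have "U \<inter> topspace (cell_topology (pverts H) \<eta>) =
      {x \<in> topspace (cell_topology (pverts H) \<eta>). id x \<in> U}"
    by auto
  ultimately show "openin (cell_topology (pverts H) \<eta>) {x \<in> topspace (cell_topology (pverts H) \<eta>). id x \<in> U}"
    by simp
qed

text \<open>
  The universal property of the weak topology: continuity is tested on the closed cells.
\<close>

lemma continuous_map_from_hom_complex:
  assumes "\<And>\<eta>. \<eta> \<in> hom_cells H G \<Longrightarrow> continuous_map (cell_topology (pverts H) \<eta>) Y f"
  shows "continuous_map (hom_complex H G) Y f"
  unfolding continuous_map_def
proof (intro conjI allI impI)
  show "f \<in> topspace (hom_complex H G) \<rightarrow> topspace Y"
    using assms by (auto simp: topspace_hom_complex continuous_map_def Pi_iff)
  fix V
  assume V: "openin Y V"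
  have "{x \<in> topspace (hom_complex H G). f x \<in> V} \<inter> topspace (cell_topology (pverts H) \<eta>) =
      {x \<in> topspace (cell_topology (pverts H) \<eta>). f x \<in> V}" if "\<eta> \<in> hom_cells H G" for \<eta>
    using that by (auto simp: topspace_hom_complex)
  then show "openin (hom_complex H G) {x \<in> topspace (hom_complex H G). f x \<in> V}"
    using assms V by (auto simp: openin_hom_complex topspace_hom_complex continuous_map_def)
qed

lemma topspace_cell:
  "p \<in> topspace (cell_topology V \<eta>) \<longleftrightarrow> p \<in> extensional V \<and> (\<forall>v\<in>V. p v \<in> vertex_simplex (\<eta> v))"
  by (auto simp: cell_topology_def PiE_def Pi_iff)

text \<open>
  The action of an endomorphism of \<open>H\<close> on the points and on the cells of the Hom complex. The
  restriction keeps functions undefined outside the vertex set, as in a product topology.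
\<close>

definition pull_back :: "'h set \<Rightarrow> ('h \<Rightarrow> 'h) \<Rightarrow> ('h \<Rightarrow> 'b) \<Rightarrow> 'h \<Rightarrow> 'b" where
  "pull_back V \<phi> p = restrict (p \<circ> \<phi>) V"

lemma pull_back_apply: "v \<in> V \<Longrightarrow> pull_back V \<phi> p v = p (\<phi> v)"
  by (simp add: pull_back_def)

lemma pull_back_in_hom_cells:
  assumes "graph_hom \<phi> H H" "parcs H \<subseteq> pverts H \<times> pverts H" "\<eta> \<in> hom_cells H G"
  shows "pull_back (pverts H) \<phi> \<eta> \<in> hom_cells H G"
proof -
  let ?V = "pverts H"
  have \<phi>: "\<phi> v \<in> ?V" if "v \<in> ?V" for v
    using assms(1) that by (auto simp: graph_hom_def)
  have "pull_back ?V \<phi> \<eta> \<in> ?V \<rightarrow>\<^sub>E {S. finite S \<and> S \<noteq> {} \<and> S \<subseteq> pverts G}"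
  proof (rule PiE_I)
    fix v assume "v \<in> ?V"
    then show "pull_back ?V \<phi> \<eta> v \<in> {S. finite S \<and> S \<noteq> {} \<and> S \<subseteq> pverts G}"
      using assms(3) \<phi>[of v] unfolding hom_cells_def pull_back_def by (simp add: PiE_def Pi_iff)
  qed (simp add: pull_back_def)
  moreover have "(x, y) \<in> parcs G"
    if vw: "(v, w) \<in> parcs H" and xy: "x \<in> pull_back ?V \<phi> \<eta> v" "y \<in> pull_back ?V \<phi> \<eta> w" for v w x y
  proof -
    have "(\<phi> v, \<phi> w) \<in> parcs H"
      using assms(1) vw by (auto simp: graph_hom_def)
    moreover have "v \<in> ?V" "w \<in> ?V"
      using assms(2) vw by auto
    ultimately show ?thesis
      using assms(3) xy by (auto simp: hom_cells_def pull_back_def)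
  qed
  ultimately show ?thesis
    unfolding hom_cells_def by blast
qed

lemma continuous_map_pull_back:
  assumes \<phi>: "graph_hom \<phi> H H" and "parcs H \<subseteq> pverts H \<times> pverts H"
  shows "continuous_map (hom_complex H G) (hom_complex H G) (pull_back (pverts H) \<phi>)"
proof (rule continuous_map_from_hom_complex)
  fix \<eta>
  assume \<eta>: "\<eta> \<in> hom_cells H G"
  let ?V = "pverts H"
  let ?\<eta>' = "pull_back ?V \<phi> \<eta>"
  have V: "\<phi> v \<in> ?V" if "v \<in> ?V" for v
    using \<phi> that by (auto simp: graph_hom_def)
  have "continuous_map (cell_topology ?V \<eta>) (cell_topology ?V ?\<eta>') (pull_back ?V \<phi>)"
    unfolding cell_topology_def continuous_map_componentwise
  proof (intro conjI ballI)
    fix v assume v: "v \<in> ?V"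
    have "continuous_map (product_topology (\<lambda>v. top_of_set (vertex_simplex (\<eta> v))) ?V)
        (top_of_set (vertex_simplex (\<eta> (\<phi> v)))) (\<lambda>p. p (\<phi> v))"
      using V[OF v] by (rule continuous_map_product_projection)
    then show "continuous_map (product_topology (\<lambda>v. top_of_set (vertex_simplex (\<eta> v))) ?V)
        (top_of_set (vertex_simplex (?\<eta>' v))) (\<lambda>p. pull_back ?V \<phi> p v)"
      using v by (simp add: pull_back_def)
  qed (auto simp: pull_back_def)
  then show "continuous_map (cell_topology ?V \<eta>) (hom_complex H G) (pull_back ?V \<phi>)"
    using continuous_map_compose continuous_map_cell_inclusion[OF pull_back_in_hom_cells[OF assms \<eta>]]
    by (metis id_comp)
qed

text \<open>
  The coordinates of the image of \<open>p v\<close> under the map of simplices induced by the colouring. The sum is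
  over the support of \<open>p v\<close>, which is finite for points of the complex, so that no cell
  containing \<open>p\<close> has to be chosen.
\<close>

definition colour_mass :: "('a \<Rightarrow> nat) \<Rightarrow> ('h \<Rightarrow> 'a \<Rightarrow> real) \<Rightarrow> 'h \<Rightarrow> nat \<Rightarrow> real" where
  "colour_mass c p v i = (\<Sum>x | p v x \<noteq> 0 \<and> c x = i. p v x)"

lemma colour_mass_cell:
  assumes "finite (\<eta> v)" "p v \<in> vertex_simplex (\<eta> v)"
  shows "colour_mass c p v i = (\<Sum>x \<in> {x \<in> \<eta> v. c x = i}. p v x)"
  unfolding colour_mass_def using assms
  by (intro sum.mono_neutral_left) (auto simp: vertex_simplex_def)

lemma hom_complex_cell:
  assumes "p \<in> topspace (hom_complex H G)"
  obtains \<eta> where "\<eta> \<in> hom_cells H G" "\<And>v. v \<in> pverts H \<Longrightarrow> p v \<in> vertex_simplex (\<eta> v)"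
    "\<And>v. v \<in> pverts H \<Longrightarrow> finite (\<eta> v) \<and> \<eta> v \<subseteq> pverts G"
proof -
  obtain \<eta> where \<eta>: "\<eta> \<in> hom_cells H G" "p \<in> topspace (cell_topology (pverts H) \<eta>)"
    using assms by (auto simp: topspace_hom_complex)
  have "finite (\<eta> v) \<and> \<eta> v \<subseteq> pverts G" if "v \<in> pverts H" for v
    using \<eta>(1) that by (simp add: hom_cells_def PiE_def Pi_iff)
  then show thesis
    using that[OF \<eta>(1)] \<eta>(2) by (simp add: topspace_cell)
qed

lemma continuous_map_colour_mass:
  assumes "v \<in> pverts H"
  shows "continuous_map (hom_complex H G) euclideanreal (\<lambda>p. colour_mass c p v i)"
proof (rule continuous_map_from_hom_complex)
  fix \<eta>
  assume \<eta>: "\<eta> \<in> hom_cells H G"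
  then have fin: "finite (\<eta> v)"
    using assms by (auto simp: hom_cells_def PiE_def Pi_iff)
  have proj: "continuous_map (cell_topology (pverts H) \<eta>) (top_of_set (vertex_simplex (\<eta> v))) (\<lambda>p. p v)"
    unfolding cell_topology_def using assms by (rule continuous_map_product_projection)
  have "continuous_on (vertex_simplex (\<eta> v)) (\<lambda>q. q x)" for x
    by (intro continuous_on_product_coordinates continuous_on_subset[OF continuous_on_product_coordinates]) auto
  then have eval: "continuous_map (top_of_set (vertex_simplex (\<eta> v))) euclideanreal (\<lambda>q. q x)" for x
    by simp
  have coord: "continuous_map (cell_topology (pverts H) \<eta>) euclideanreal (\<lambda>p. p v x)" for x
    using continuous_map_compose[OF proj eval[of x]] by (simp add: o_def)
  have "continuous_map (cell_topology (pverts H) \<eta>) euclideanreal (\<lambda>p. \<Sum>x \<in> {x \<in> \<eta> v. c x = i}. p v x)"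
    using fin by (intro continuous_map_sum coord) auto
  then show "continuous_map (cell_topology (pverts H) \<eta>) euclideanreal (\<lambda>p. colour_mass c p v i)"
  proof (rule continuous_map_eq)
    show "(\<Sum>x \<in> {x \<in> \<eta> v. c x = i}. p v x) = colour_mass c p v i"
      if "p \<in> topspace (cell_topology (pverts H) \<eta>)" for p
      using that assms fin colour_mass_cell[of \<eta> v p c i] by (simp add: topspace_cell)
  qed
qed

lemma sum_colour_mass:
  assumes p: "p \<in> topspace (hom_complex H G)" and v: "v \<in> pverts H"
    and c: "graph_hom c G (complete_graph m)"
  shows "(\<Sum>i<m. colour_mass c p v i) = 1"
proof -
  obtain \<eta> where \<eta>: "p v \<in> vertex_simplex (\<eta> v)" "finite (\<eta> v)" "\<eta> v \<subseteq> pverts G"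
    by (rule hom_complex_cell[OF p]) (use v in blast)
  have "c ` \<eta> v \<subseteq> {..<m}"
    using c \<eta>(3) by (auto simp: graph_hom_def complete_graph_def)
  then have "(\<Sum>i<m. \<Sum>x \<in> {x \<in> \<eta> v. c x = i}. p v x) = (\<Sum>x \<in> \<eta> v. p v x)"
    using \<eta>(2) by (intro sum.group) auto
  then show ?thesis
    using \<eta>(1) colour_mass_cell[of \<eta> v p c] \<eta>(2) by (simp add: vertex_simplex_def)
qed

text \<open>
  Vertices in the supports at \<open>v\<close> and \<open>w\<close> are adjacent in \<open>G\<close>, hence differ in colour.
\<close>

lemma colour_mass_adjacent:
  assumes p: "p \<in> topspace (hom_complex H G)" and vw: "(v, w) \<in> parcs H" "v \<in> pverts H" "w \<in> pverts H"
    and c: "graph_hom c G (complete_graph m)"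
  shows "colour_mass c p v i = 0 \<or> colour_mass c p w i = 0"
proof (rule ccontr)
  assume "\<not> ?thesis"
  then obtain x y where xy: "p v x \<noteq> 0" "c x = i" "p w y \<noteq> 0" "c y = i"
    unfolding colour_mass_def by (smt (verit) mem_Collect_eq sum.neutral)
  obtain \<eta> where \<eta>: "\<eta> \<in> hom_cells H G" "\<And>v. v \<in> pverts H \<Longrightarrow> p v \<in> vertex_simplex (\<eta> v)"
    by (rule hom_complex_cell[OF p], rule that) blast+
  have "x \<in> \<eta> v" "y \<in> \<eta> w"
    using \<eta>(2) vw xy by (auto simp: vertex_simplex_def)
  then have "(x, y) \<in> parcs G"
    using \<eta>(1) vw(1) by (auto simp: hom_cells_def)
  then have "(c x, c y) \<in> parcs (complete_graph m)"
    using c by (auto simp: graph_hom_def)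
  then show False
    using xy by (simp add: complete_graph_def)
qed

lemma colour_mass_pull_back:
  "v \<in> V \<Longrightarrow> colour_mass c (pull_back V \<phi> p) v i = colour_mass c p (\<phi> v) i"
  by (simp add: colour_mass_def pull_back_def)

section \<open>The odd cycle\<close>

text \<open>
  The reflection \<open>v \<mapsto> - v\<close> modulo \<open>m\<close>. For \<open>m = 2 * r + 1\<close> it exchanges \<open>r\<close> and \<open>r + 1\<close>.
\<close>

definition reflection :: "nat \<Rightarrow> nat \<Rightarrow> nat" where
  "reflection m v = (if v = 0 then 0 else m - v)"

lemma graph_hom_reflection: "graph_hom (reflection m) (circular_graph m) (circular_graph m)"
proof -
  have "(reflection m i, reflection m j) \<in> parcs (circular_graph m) \<and>
      (reflection m j, reflection m i) \<in> parcs (circular_graph m)"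
    if "i < m" "j = (i + 1) mod m" for i j
  proof (cases "i + 1 = m")
    case True
    then show ?thesis
      using that by (auto simp: circular_graph_def reflection_def mod_Suc)
  next
    case False
    then have "j = i + 1" "j < m"
      using that by auto
    then show ?thesis
      using that by (auto simp: circular_graph_def reflection_def mod_Suc Suc_diff_Suc)
  qed
  then have "(reflection m i, reflection m j) \<in> parcs (circular_graph m)"
    if "(i, j) \<in> parcs (circular_graph m)" for i j
    using that by (auto simp: circular_graph_def)
  moreover have "reflection m i \<in> pverts (circular_graph m)" if "i \<in> pverts (circular_graph m)" for i
    using that by (auto simp: circular_graph_def reflection_def)
  ultimately show ?thesis
    unfolding graph_hom_def by blast
qed

lemma parcs_circular_graph: "parcs (circular_graph m) \<subseteq> pverts (circular_graph m) \<times> pverts (circular_graph m)"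
  by (auto simp: circular_graph_def)

lemma edge_circular_graph:
  assumes "Suc i < m"
  shows "(i, Suc i) \<in> parcs (circular_graph m)" "(Suc i, i) \<in> parcs (circular_graph m)"
  using assms by (auto simp: circular_graph_def)

text \<open>
  The radial projection to the sphere of dimension \<open>n\<close>, after forgetting all coordinates beyond \<open>n\<close>.
\<close>

definition normalise :: "nat \<Rightarrow> (nat \<Rightarrow> real) \<Rightarrow> nat \<Rightarrow> real" where
  "normalise n y = (\<lambda>i. if i \<le> n then y i / sqrt (\<Sum>j\<le>n. (y j)\<^sup>2) else 0)"

lemma normalise_minus: "normalise n (\<lambda>i. - y i) = antipode (normalise n y)"
  by (auto simp: normalise_def antipode_def)

lemma sum_squares_pos:
  fixes y :: "nat \<Rightarrow> real"
  assumes "\<exists>i\<le>n. y i \<noteq> 0"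
  shows "(\<Sum>j\<le>n. (y j)\<^sup>2) > 0"
proof -
  obtain i where "i \<le> n" "y i \<noteq> 0"
    using assms by blast
  then show ?thesis
    by (intro sum_pos2[of _ i]) auto
qed

lemma normalise_in_nsphere:
  assumes "\<exists>i\<le>n. y i \<noteq> 0"
  shows "normalise n y \<in> topspace (nsphere n)"
  using sum_squares_pos[OF assms]
  by (simp add: topspace_nsphere normalise_def power_divide flip: sum_divide_distrib)

lemma continuous_map_normalise:
  assumes "\<And>i. i \<le> n \<Longrightarrow> continuous_map X euclideanreal (\<lambda>x. f x i)"
    and "\<And>x. x \<in> topspace X \<Longrightarrow> \<exists>i\<le>n. f x i \<noteq> 0"
  shows "continuous_map X (nsphere n) (\<lambda>x. normalise n (f x))"
proof -
  have "continuous_map X euclideanreal (\<lambda>x. normalise n (f x) i)" for i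
  proof (cases "i \<le> n")
    case True
    have "sqrt (\<Sum>j\<le>n. (f x j)\<^sup>2) \<noteq> 0" if "x \<in> topspace X" for x
      using sum_squares_pos[OF assms(2)[OF that]] by simp
    then show ?thesis
      unfolding normalise_def using True
      by (simp, intro continuous_intros assms(1)) auto
  qed (simp add: normalise_def)
  moreover have "(\<lambda>x. normalise n (f x)) \<in> topspace X \<rightarrow> {x. (\<Sum>i\<le>n. (x i)\<^sup>2) = 1 \<and> (\<forall>i>n. x i = 0)}"
    using normalise_in_nsphere assms(2) by (auto simp: topspace_nsphere)
  ultimately show ?thesis
    unfolding nsphere by (simp add: continuous_map_in_subtopology continuous_map_componentwise_UNIV image_subset_iff_funcset)
qed

lemma homotopic_normalise:
  assumes f: "\<And>i. i \<le> n \<Longrightarrow> continuous_map X euclideanreal (\<lambda>x. f x i)"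
    and g: "\<And>i. i \<le> n \<Longrightarrow> continuous_map X euclideanreal (\<lambda>x. g x i)"
    and nz: "\<And>x t. x \<in> topspace X \<Longrightarrow> t \<in> {0..1} \<Longrightarrow> \<exists>i\<le>n. (1 - t) * f x i + t * g x i \<noteq> 0"
  shows "homotopic_with (\<lambda>_. True) X (nsphere n) (\<lambda>x. normalise n (f x)) (\<lambda>x. normalise n (g x))"
proof -
  let ?P = "prod_topology (top_of_set {0..1::real}) X"
  define h where "h = (\<lambda>(t, x) i. (1 - t) * f x i + t * g x i)"
  have t: "continuous_map ?P euclideanreal fst"
    using continuous_map_fst[of "top_of_set {0..1::real}" X] by (auto simp: continuous_map_in_subtopology)
  have "continuous_map ?P (nsphere n) (\<lambda>p. normalise n (h p))"
  proof (rule continuous_map_normalise)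
    show "continuous_map ?P euclideanreal (\<lambda>p. h p i)" if "i \<le> n" for i
      unfolding h_def case_prod_unfold
      using continuous_map_compose[OF continuous_map_snd f[OF that]]
        continuous_map_compose[OF continuous_map_snd g[OF that]]
      by (intro continuous_intros t) (auto simp: o_def)
  qed (use nz in \<open>auto simp: h_def\<close>)
  then show ?thesis
    unfolding homotopic_with_def
    by (intro exI[of _ "\<lambda>p. normalise n (h p)"]) (simp add: h_def)
qed

text \<open>
  As the coordinate sums are equal, agreement in all coordinates but the last implies equality, and
  equal vectors with disjoint supports vanish, which contradicts the sum 1. The last coordinate of
  the difference can therefore be forgotten without losing that the difference is nonzero.
\<close>

lemma disjoint_distributions_differ:
  fixes P Q :: "nat \<Rightarrow> real"
  assumes "(\<Sum>i<n + 2. P i) = 1" "(\<Sum>i<n + 2. Q i) = 1" "\<And>i. i < n + 2 \<Longrightarrow> P i = 0 \<or> Q i = 0"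
  shows "\<exists>i\<le>n. P i \<noteq> Q i"
proof (rule ccontr)
  assume "\<not> ?thesis"
  then have eq: "P i = Q i" if "i < Suc n" for i
    using that by auto
  then have "P (Suc n) = Q (Suc n)"
    using assms(1,2) by simp
  then have "P i = 0" if "i < n + 2" for i
    using that eq assms(3)[OF that] by (cases "i = Suc n") auto
  then show False
    using assms(1) by simp
qed

text \<open>
  The family \<open>a\<close> is what a colouring with \<open>n + 2\<close> colours makes of an equivariant map from the sphere
  to the Hom complex of the odd cycle.
\<close>

theorem no_antipodal_odd_cycle_of_distributions:
  fixes a :: "nat \<Rightarrow> (nat \<Rightarrow> real) \<Rightarrow> nat \<Rightarrow> real"
  assumes n: "n \<ge> 1" and r: "r \<ge> 1"
    and cont: "\<And>v i. v \<le> 2 * r \<Longrightarrow> continuous_map (nsphere n) euclideanreal (\<lambda>x. a v x i)"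
    and sum: "\<And>v x. v \<le> 2 * r \<Longrightarrow> x \<in> topspace (nsphere n) \<Longrightarrow> (\<Sum>i<n + 2. a v x i) = 1"
    and adjacent: "\<And>v w x i. (v, w) \<in> parcs (circular_graph (2 * r + 1)) \<Longrightarrow> x \<in> topspace (nsphere n) \<Longrightarrow>
       a v x i = 0 \<or> a w x i = 0"
    and antipodal: "\<And>v x i. v \<le> 2 * r \<Longrightarrow> x \<in> topspace (nsphere n) \<Longrightarrow>
       a v (antipode x) i = a (reflection (2 * r + 1) v) x i"
  shows False
proof -
  let ?S = "nsphere n"
  let ?C = "parcs (circular_graph (2 * r + 1))"
  define hom where "hom f g = homotopic_with (\<lambda>_. True) ?S ?S (\<lambda>x. normalise n (f x)) (\<lambda>x. normalise n (g x))"
    for f g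
  define D where "D v w x i = a v x i - a w x i" for v w x i
  have trans: "hom f h" if "hom f g" "hom g h" for f g h
    using that unfolding hom_def by (rule homotopic_with_trans)
  have verts: "v \<le> 2 * r" "w \<le> 2 * r" if "(v, w) \<in> ?C" for v w
    using that by (auto simp: circular_graph_def)
  have sym: "(w, v) \<in> ?C" if "(v, w) \<in> ?C" for v w
    using that by (auto simp: circular_graph_def)
  \<comment> \<open>Moving linearly between two neighbours of a vertex keeps the supports disjoint.\<close>
  have segment: "\<exists>i\<le>n. (1 - s) * a v x i + s * a v' x i \<noteq> (1 - t) * a w x i + t * a w' x i"
    if x: "x \<in> topspace ?S" and e: "(v, w) \<in> ?C" "(v', w) \<in> ?C" "(v, w') \<in> ?C" "(v', w') \<in> ?C" for v v' w w' x s t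
  proof (rule disjoint_distributions_differ)
    show "(\<Sum>i<n + 2. (1 - s) * a v x i + s * a v' x i) = 1"
      using sum[OF verts(1)[OF e(1)] x] sum[OF verts(1)[OF e(2)] x]
      by (simp only: sum.distrib flip: sum_distrib_left) simp
    show "(\<Sum>i<n + 2. (1 - t) * a w x i + t * a w' x i) = 1"
      using sum[OF verts(2)[OF e(1)] x] sum[OF verts(2)[OF e(3)] x]
      by (simp only: sum.distrib flip: sum_distrib_left) simp
    show "(1 - s) * a v x i + s * a v' x i = 0 \<or> (1 - t) * a w x i + t * a w' x i = 0" for i
      using adjacent[OF e(1) x, of i] adjacent[OF e(2) x, of i] adjacent[OF e(3) x, of i] adjacent[OF e(4) x, of i]
      by auto
  qed
  have first: "hom (D v w) (D v' w)" if e: "(v, w) \<in> ?C" "(v', w) \<in> ?C" for v v' w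
    unfolding hom_def
  proof (rule homotopic_normalise)
    fix x t
    assume x: "x \<in> topspace ?S"
    have "(1 - t) * D v w x i + t * D v' w x i = ((1 - t) * a v x i + t * a v' x i) - ((1 - t) * a w x i + t * a w x i)" for i
      by (simp add: D_def algebra_simps)
    then show "\<exists>i\<le>n. (1 - t) * D v w x i + t * D v' w x i \<noteq> 0"
      using segment[OF x e e, of t t] by simp
  qed (use verts e in \<open>auto simp: D_def intro!: continuous_intros cont\<close>)
  have second: "hom (D v w) (D v w')" if e: "(v, w) \<in> ?C" "(v, w') \<in> ?C" for v w w'
    unfolding hom_def
  proof (rule homotopic_normalise)
    fix x t
    assume x: "x \<in> topspace ?S"
    have "(1 - t) * D v w x i + t * D v w' x i = ((1 - t) * a v x i + t * a v x i) - ((1 - t) * a w x i + t * a w' x i)" for i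
      by (simp add: D_def algebra_simps)
    then show "\<exists>i\<le>n. (1 - t) * D v w x i + t * D v w' x i \<noteq> 0"
      using segment[OF x e(1) e(1) e(2) e(2), of t t] by simp
  qed (use verts e in \<open>auto simp: D_def intro!: continuous_intros cont\<close>)
  \<comment> \<open>Each step replaces one end of the current edge, so that the vertex moved alternates between
     the two arguments of \<open>D\<close>; the parity of \<open>k\<close> records which of them is \<open>k\<close>.\<close>
  have walk: "hom (D 0 1) (if even k then D k (Suc k) else D (Suc k) k)" if "k \<le> r" for k
    using that
  proof (induction k)
    case 0
    have "hom (D 0 1) (D 0 1)"
      using first[of 0 1 0] edge_circular_graph(1)[of 0 "2 * r + 1"] r by simp
    then show ?case
      by simp
  next
    case (Suc k)
    have e: "(k, Suc k) \<in> ?C" "(Suc k, k) \<in> ?C" "(Suc k, Suc (Suc k)) \<in> ?C" "(Suc (Suc k), Suc k) \<in> ?C"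
      using Suc.prems r by (auto intro!: edge_circular_graph)
    have "hom (D k (Suc k)) (D (Suc (Suc k)) (Suc k))" "hom (D (Suc k) k) (D (Suc k) (Suc (Suc k)))"
      using first[OF e(1,4)] second[OF e(2,3)] by auto
    then show ?case
      using Suc trans by (cases "even k") auto
  qed
  define F where "F = (if even r then D r (Suc r) else D (Suc r) r)"
  define E where "E x i = a 0 x i - (a 1 x i + a (2 * r) x i) / 2" for x i
  have e0: "(0, 1) \<in> ?C" "(0, 2 * r) \<in> ?C"
    using r by (auto simp: circular_graph_def)
  have "hom (D 0 1) E"
    unfolding hom_def
  proof (rule homotopic_normalise)
    fix x t
    assume x: "x \<in> topspace ?S"
    have "(1 - t) * D 0 1 x i + t * E x i =
        ((1 - t) * a 0 x i + t * a 0 x i) - ((1 - t / 2) * a 1 x i + (t / 2) * a (2 * r) x i)" for i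
      by (simp add: D_def E_def field_simps)
    then show "\<exists>i\<le>n. (1 - t) * D 0 1 x i + t * E x i \<noteq> 0"
      using segment[OF x e0(1) e0(1) e0(2) e0(2), of t "t / 2"] by simp
  qed (use r in \<open>auto simp: D_def E_def intro!: continuous_intros cont\<close>)
  moreover have "hom F (D 0 1)"
    using walk[of r] unfolding F_def hom_def by (auto intro: homotopic_with_symD)
  ultimately have "hom F E"
    using trans by blast
  then have FE: "homotopic_with (\<lambda>_. True) ?S ?S (\<lambda>x. normalise n (F x)) (\<lambda>x. normalise n (E x))"
    by (simp add: hom_def)
  have "F (antipode x) = (\<lambda>i. - F x i)" if "x \<in> topspace ?S" for x
    using antipodal[OF _ that, of r] antipodal[OF _ that, of "Suc r"] r
    by (auto simp: F_def D_def reflection_def fun_eq_iff mult_2)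
  then have odd: "normalise n (F (antipode x)) = antipode (normalise n (F x))" if "x \<in> topspace ?S" for x
    using that by (simp add: normalise_minus)
  have "E (antipode x) = E x" if "x \<in> topspace ?S" for x
    using antipodal[OF _ that, of 0] antipodal[OF _ that, of 1] antipodal[OF _ that, of "2 * r"] r
    by (auto simp: E_def reflection_def fun_eq_iff)
  then have even: "normalise n (E (antipode x)) = normalise n (E x)" if "x \<in> topspace ?S" for x
    using that by simp
  show False
    using odd_map_not_homotopic_to_even_map[OF n FE odd even] .
qed

theorem theorem1p9:
  fixes \<Gamma> :: "'a pair_pre_digraph" and r n :: nat
  assumes "pair_sym_digraph \<Gamma>"
    and "r \<ge> 1" and "n \<ge> 2"
    and "k_connected (n - 1) (hom_complex (circular_graph (2 * r + 1)) \<Gamma>)"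
  shows "\<not> colorable (n + 2) \<Gamma>"
proof
  assume "colorable (n + 2) \<Gamma>"
  then obtain c where c: "graph_hom c \<Gamma> (complete_graph (n + 2))"
    unfolding colorable_def by blast
  let ?m = "2 * r + 1"
  let ?C = "circular_graph ?m"
  let ?X = "hom_complex ?C \<Gamma>"
  let ?\<sigma> = "pull_back (pverts ?C) (reflection ?m)"
  have V: "v \<in> pverts ?C \<longleftrightarrow> v \<le> 2 * r" for v
    by (auto simp: circular_graph_def)
  have refl: "reflection ?m v \<le> 2 * r" "reflection ?m (reflection ?m v) = v" if "v \<le> 2 * r" for v
    using that by (auto simp: reflection_def)
  have \<sigma>: "continuous_map ?X ?X ?\<sigma>"
    by (rule continuous_map_pull_back[OF graph_hom_reflection parcs_circular_graph])
  have inv: "?\<sigma> (?\<sigma> p) = p" if "p \<in> topspace ?X" for p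
  proof (rule extensionalityI[of _ "pverts ?C"])
    show "p \<in> extensional (pverts ?C)"
      using that by (auto simp: topspace_hom_complex topspace_cell)
    show "?\<sigma> (?\<sigma> p) v = p v" if "v \<in> pverts ?C" for v
      using that V refl pull_back_apply by metis
  qed (simp add: pull_back_def)
  have "\<exists>s. continuous_map (nsphere n) ?X s \<and> (\<forall>x \<in> topspace (nsphere n). s (antipode x) = ?\<sigma> (s x))"
    using assms(4) by (intro equivariant_map_from_sphere \<sigma> inv) (auto simp: k_connected_def)
  then obtain s where s: "continuous_map (nsphere n) ?X s"
      "\<And>x. x \<in> topspace (nsphere n) \<Longrightarrow> s (antipode x) = ?\<sigma> (s x)"
    by blast
  have sX: "s x \<in> topspace ?X" if "x \<in> topspace (nsphere n)" for x
    using s(1) that by (auto simp: continuous_map_def Pi_iff)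
  show False
  proof (rule no_antipodal_odd_cycle_of_distributions[of n r "\<lambda>v x. colour_mass c (s x) v"])
    show "continuous_map (nsphere n) euclideanreal (\<lambda>x. colour_mass c (s x) v i)" if "v \<le> 2 * r" for v i
      using continuous_map_compose[OF s(1) continuous_map_colour_mass] that V by (fastforce simp: o_def)
    show "(\<Sum>i<n + 2. colour_mass c (s x) v i) = 1" if "v \<le> 2 * r" "x \<in> topspace (nsphere n)" for v x
      using sum_colour_mass[OF sX[OF that(2)] _ c] that(1) V by blast
    show "colour_mass c (s x) v i = 0 \<or> colour_mass c (s x) w i = 0"
      if "(v, w) \<in> parcs ?C" "x \<in> topspace (nsphere n)" for v w x i
      using colour_mass_adjacent[OF sX[OF that(2)] that(1) _ _ c] that(1) parcs_circular_graph by blast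
    show "colour_mass c (s (antipode x)) v i = colour_mass c (s x) (reflection ?m v) i"
      if "v \<le> 2 * r" "x \<in> topspace (nsphere n)" for v x i
      using s(2)[OF that(2)] colour_mass_pull_back that(1) V by metis
  qed (use assms in auto)
qed

end
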